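(* Let $G$ be a connected bipartite graph with color classes $E$ and $V$, let $\mathscr T$ be a triangulation of its root polytope $Q_G$, fix a linear order on $E$, and let $k\ge0$ be an integer. Then the number of interior simplices of $\mathscr T$ of codimension $k$ (i.e. of dimension $|E|+|V|-2-k$) equals the number of pairs $(\mathbf f,S)$ where $\mathbf f$ is a hypertree of the hypergraph $(V,E)$ and $S$ is a set of exactly $k$ distinct hyperedges that are internally inactive with respect to $\mathbf f$.
   Context: Bipartite graphs have no multiple edges. $Q_G\subset\mathbf R^E\oplus\mathbf R^V$ is the convex hull of $\mathbf i_{\{e\}}+\mathbf i_{\{v\}}$ over edges $ev$ of $G$ ($\mathbf i$ = indicator vector); its dimension is $|E|+|V|-2$. A triangulation is a collection of full-dimensional simplices spanned by vertices of $Q_G$, pairwise meeting in common faces, with union $Q_G$; its simplices are all faces of these. A simplex of $\mathscr T$ is interior if it is not contained in the boundary of $Q_G$. A hypertree of $(V,E)$ is a function $\mathbf f\colon E\to\mathbf N$ such that some spanning tree of $G$ has degree $\mathbf f(e)+1$ at each $e\in E$. A hyperedge $e\in E$ is internally active with respect to $\mathbf f$ if there is no $e'<e$ such that decreasing $\mathbf f(e)$ by $1$ and increasing $\mathbf f(e')$ by $1$ yields another hypertree; otherwise it is internally inactive. *)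

theory Defs
  imports "HOL-Analysis.Analysis"
begin

text \<open>A bipartite graph on the node type 'a is given by its edge set Ed, a set of
pairs (e, v) with e in the colour class E and v in the colour class V
(no multiple edges).  The ambient space R^E + R^V is real^'a, where
E and V partition the finite type 'a.\<close>

text \<open>Every pair of nodes of N is joined by a path using edges of T.\<close>
definition connected_by :: "'a set \<Rightarrow> ('a \<times> 'a) set \<Rightarrow> bool" where
  "connected_by N T \<longleftrightarrow> (\<forall>x\<in>N. \<forall>y\<in>N. (x, y) \<in> (T \<union> T\<inverse>)\<^sup>*)"

text \<open>Spanning tree of the graph (N, Ed): a minimally connected spanning subgraph.\<close>
definition spanning_tree :: "'a set \<Rightarrow> ('a \<times> 'a) set \<Rightarrow> ('a \<times> 'a) set \<Rightarrow> bool" where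
  "spanning_tree N Ed T \<longleftrightarrow> T \<subseteq> Ed \<and> connected_by N T \<and>
     (\<forall>t\<in>T. \<not> connected_by N (T - {t}))"

text \<open>Hypertree of the hypergraph (V, E) induced by G: f e + 1 is the degree of e
in some spanning tree of G, for every e in E.\<close>
definition hypertree :: "'a set \<Rightarrow> 'a set \<Rightarrow> ('a \<times> 'a) set \<Rightarrow> ('a \<Rightarrow> nat) \<Rightarrow> bool" where
  "hypertree E V Ed f \<longleftrightarrow>
     (\<exists>T. spanning_tree (E \<union> V) Ed T \<and> (\<forall>e\<in>E. card {v. (e, v) \<in> T} = f e + 1))"

text \<open>Internal inactivity with respect to the linear order r on E
(e' < e means (e', e) in r and e' different from e).\<close>
definition internally_inactive ::
  "('a \<times> 'a) set \<Rightarrow> 'a set \<Rightarrow> 'a set \<Rightarrow> ('a \<times> 'a) set \<Rightarrow> ('a \<Rightarrow> nat) \<Rightarrow> 'a \<Rightarrow> bool" where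
  "internally_inactive r E V Ed f e \<longleftrightarrow>
     (\<exists>e'\<in>E. (e', e) \<in> r \<and> e' \<noteq> e \<and> f e \<ge> 1 \<and>
        hypertree E V Ed (f(e := f e - 1, e' := f e' + 1)))"

text \<open>Generating point i_{e} + i_{v} of the root polytope.\<close>
definition root_pt :: "'a::finite \<Rightarrow> 'a \<Rightarrow> real ^ 'a" where
  "root_pt e v = axis e 1 + axis v 1"

definition root_polytope :: "('a::finite \<times> 'a) set \<Rightarrow> (real ^ 'a) set" where
  "root_polytope Ed = convex hull {root_pt e v | e v. (e, v) \<in> Ed}"

text \<open>A triangulation, given by the vertex sets of its maximal simplices.\<close>
definition triangulation :: "(real ^ 'a::finite) set \<Rightarrow> (real ^ 'a) set set \<Rightarrow> bool" where
  "triangulation Q \<T> \<longleftrightarrow>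
     (\<forall>\<tau>\<in>\<T>. \<tau> \<subseteq> {x. x extreme_point_of Q} \<and> \<not> affine_dependent \<tau> \<and>
        aff_dim (convex hull \<tau>) = aff_dim Q) \<and>
     (\<forall>\<tau>1\<in>\<T>. \<forall>\<tau>2\<in>\<T>. convex hull \<tau>1 \<inter> convex hull \<tau>2 = convex hull (\<tau>1 \<inter> \<tau>2)) \<and>
     \<Union> ((\<lambda>\<tau>. convex hull \<tau>) ` \<T>) = Q"

end

theory Submission
  imports Defs
begin

text \<open>
  Spanning trees of \<open>G\<close> are exactly the bases formed by generating points in the hyperplane
  \<open>W\<close> of vectors with equal \<open>E\<close>- and \<open>V\<close>-sum, so the maximal simplices of a triangulation are
  spanning trees. For a hypertree \<open>h\<close> the point \<open>q = (h + 1/|E|, 1)\<close>, scaled by \<open>1/|V|\<close>, lies in the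
  interior of \<open>Q\<close>. It is generic: in the basis given by any spanning tree \<open>T\<close> all its coordinates
  are nonzero, and they are all positive iff \<open>T\<close> has hypertree \<open>h\<close>. Moving the points of an interior
  face \<open>F\<close> slightly away from \<open>q\<close> selects one maximal simplex \<open>T\<close>, so interior faces are the sets
  \<open>T - R\<close> with \<open>R\<close> among the edges of negative coordinate of \<open>q\<close>.

  Record an interior face by its reduced degree vector \<open>d(e) = deg(e) - 1\<close>. For \<open>g \<le> h\<close>, the sum
  of \<open>(-1)^codim\<close> over the interior faces with \<open>d \<ge> g\<close> is \<open>1\<close>: if \<open>T\<close> has another hypertree \<open>f\<close>, then
  \<open>f - h\<close>, viewed as a flow on \<open>T\<close>, has a source \<open>e\<close>, where \<open>f e - h e\<close> is at least the number of
  negative edges at \<open>e\<close>, so toggling one of these edges cancels all the terms of \<open>T\<close>. If \<open>g\<close>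
  lies below no hypertree the sum is empty. The pairs \<open>(f, S)\<close>, recorded by \<open>f - 1\<^sub>S\<close>, have the same
  signed sums, because among the hypertrees above \<open>g\<close> there is exactly one whose hyperedges with
  \<open>f e > g e\<close> are all active. Hence both families have equally many members over every vector \<open>d\<close>.
\<close>

section \<open>Edge vectors, degrees and fundamental cuts\<close>

definition edge_vec :: "'a::finite \<times> 'a \<Rightarrow> real ^ 'a" where
  "edge_vec t = root_pt (fst t) (snd t)"

definition deg :: "('a \<times> 'a) set \<Rightarrow> 'a \<Rightarrow> nat" where
  "deg T e = card {v. (e, v) \<in> T}"

text \<open>In a spanning tree this is the component of \<open>fst t\<close> after deleting
  \<open>t\<close>. Choosing the side of \<open>fst t\<close> fixes the sign of the functional
  \<open>coef\<close>.\<close>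

definition cut :: "('a \<times> 'a) set \<Rightarrow> 'a \<times> 'a \<Rightarrow> 'a set" where
  "cut T t = {x. (fst t, x) \<in> ((T - {t}) \<union> (T - {t})\<inverse>)\<^sup>*}"

lemma edge_vec_nth: "edge_vec t $ i = (if i = fst t then 1 else 0) + (if i = snd t then 1 else 0)"
  by (auto simp: edge_vec_def root_pt_def axis_def)

lemma fst_in_cut: "fst t \<in> cut T t"
  by (simp add: cut_def)

lemma cut_closed:
  assumes "u \<in> T" "u \<noteq> t"
  shows "fst u \<in> cut T t \<longleftrightarrow> snd u \<in> cut T t"
proof -
  have "(fst u, snd u) \<in> (T - {t}) \<union> (T - {t})\<inverse>" "(snd u, fst u) \<in> (T - {t}) \<union> (T - {t})\<inverse>"
    using assms by auto
  then show ?thesis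
    unfolding cut_def mem_Collect_eq by (meson rtrancl.rtrancl_into_rtrancl)
qed

text \<open>Serves to nest the cuts of two edges in \<open>excess_source\<close>: the intersection
  of the two cuts is closed in this sense.\<close>

lemma cut_least:
  assumes "fst t \<in> C" "\<And>u. u \<in> T \<Longrightarrow> u \<noteq> t \<Longrightarrow> fst u \<in> C \<longleftrightarrow> snd u \<in> C"
  shows "cut T t \<subseteq> C"
proof
  fix x assume "x \<in> cut T t"
  then have "(fst t, x) \<in> ((T - {t}) \<union> (T - {t})\<inverse>)\<^sup>*"
    by (simp add: cut_def)
  then show "x \<in> C"
  proof (induction rule: rtrancl_induct)
    case (step y z)
    then show ?case using assms(2)[of "(y, z)"] assms(2)[of "(z, y)"] by auto
  qed (rule assms(1))
qed

lemma sum_deg: "(\<Sum>e\<in>A. deg T e) = card {t \<in> T. fst t \<in> A}"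
  for T :: "('a::finite \<times> 'a) set"
proof -
  have *: "{t \<in> T. fst t \<in> A} = (SIGMA e:A. {v. (e, v) \<in> T})"
    by auto
  show ?thesis
    unfolding deg_def * by (rule card_SigmaI[symmetric]) auto
qed

lemma sum_edges_at:
  fixes T :: "('a::finite \<times> 'a) set"
  shows "(\<Sum>t | t \<in> T \<and> fst t = e. F t) = (\<Sum>v | (e, v) \<in> T. F (e, v))"
  by (rule sum.reindex_bij_witness[where i = "\<lambda>v. (e, v)" and j = snd]) auto

section \<open>The hyperplane of the edge vectors and its coordinate functionals\<close>

locale bipartite =
  fixes E V :: "'a::finite set" and Ed :: "('a \<times> 'a) set"
  assumes cover: "E \<union> V = UNIV" and disj: "E \<inter> V = {}"
    and E_ne: "E \<noteq> {}" and V_ne: "V \<noteq> {}"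
    and Ed_sub: "Ed \<subseteq> E \<times> V"
    and conn: "connected_by (E \<union> V) Ed"
begin

definition sgn_vec :: "real ^ 'a" where
  "sgn_vec = (\<chi> i. if i \<in> E then 1 else - 1)"

definition W :: "(real ^ 'a) set" where
  "W = {x. sgn_vec \<bullet> x = 0}"

text \<open>This is the \<open>E\<close>-sum minus the \<open>V\<close>-sum over one side of the
  cut. For a spanning tree these functionals are dual to the edge vectors, so coordinates in every
  tree basis come from one explicit formula.\<close>

definition coef :: "('a \<times> 'a) set \<Rightarrow> 'a \<times> 'a \<Rightarrow> real ^ 'a \<Rightarrow> real" where
  "coef T t x = (\<Sum>i\<in>cut T t. sgn_vec $ i * x $ i)"

abbreviation tree :: "('a \<times> 'a) set \<Rightarrow> bool" where
  "tree T \<equiv> spanning_tree (E \<union> V) Ed T"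

lemma card_nodes: "card E + card V = CARD('a)"
  using card_Un_disjoint[OF finite finite disj] by (simp add: cover)

lemma card_pos: "card E > 0" "card V > 0"
  using E_ne V_ne by (simp_all add: card_gt_0_iff)

lemma sgn_nth [simp]: "i \<in> E \<Longrightarrow> sgn_vec $ i = 1" "i \<in> V \<Longrightarrow> sgn_vec $ i = -1"
  using disj by (auto simp: sgn_vec_def)

lemma sgn_sq: "sgn_vec $ i * sgn_vec $ i = 1"
  by (simp add: sgn_vec_def)

lemma inner_sgn: "sgn_vec \<bullet> x = (\<Sum>i\<in>E. x $ i) - (\<Sum>i\<in>V. x $ i)"
proof -
  have "sgn_vec \<bullet> x = (\<Sum>i\<in>E \<union> V. sgn_vec $ i * x $ i)"
    by (simp add: inner_vec_def cover)
  also have "\<dots> = (\<Sum>i\<in>E. sgn_vec $ i * x $ i) + (\<Sum>i\<in>V. sgn_vec $ i * x $ i)"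
    by (rule sum.union_disjoint) (auto simp: disj)
  finally show ?thesis
    by (simp add: sum_negf)
qed

lemma coef_eq: "coef T t x = (\<Sum>i\<in>cut T t \<inter> E. x $ i) - (\<Sum>i\<in>cut T t \<inter> V. x $ i)"
proof -
  have "cut T t = (cut T t \<inter> E) \<union> (cut T t \<inter> V)"
    using cover by auto
  then have "coef T t x = (\<Sum>i\<in>(cut T t \<inter> E) \<union> (cut T t \<inter> V). sgn_vec $ i * x $ i)"
    unfolding coef_def by simp
  also have "\<dots> = (\<Sum>i\<in>cut T t \<inter> E. sgn_vec $ i * x $ i) + (\<Sum>i\<in>cut T t \<inter> V. sgn_vec $ i * x $ i)"
    by (rule sum.union_disjoint) (use disj in auto)
  finally show ?thesis
    by (simp add: sum_negf)
qed

lemma subspace_W: "subspace W"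
  unfolding W_def by (rule subspace_hyperplane)

lemma sgn_vec_nz: "sgn_vec \<noteq> 0"
  using E_ne by (metis all_not_in_conv sgn_nth(1) zero_index zero_neq_one)

lemma dim_W: "dim W = CARD('a) - 1"
  unfolding W_def using dim_hyperplane[OF sgn_vec_nz] by simp

lemma edge_vec_W: "t \<in> E \<times> V \<Longrightarrow> edge_vec t \<in> W"
  using disj by (auto simp: W_def edge_vec_def root_pt_def inner_axis inner_add_right)

lemma span_edges_W: "T \<subseteq> E \<times> V \<Longrightarrow> span (edge_vec ` T) \<subseteq> W"
  by (intro span_minimal subspace_W) (use edge_vec_W in blast)

lemma inj_edge_vec: "inj_on edge_vec (E \<times> V)"
proof (rule inj_onI)
  fix s t assume st: "s \<in> E \<times> V" "t \<in> E \<times> V" "edge_vec s = edge_vec t"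
  have "edge_vec s $ i = edge_vec t $ i" for i
    using st by simp
  from this[of "fst s"] this[of "snd s"] show "s = t"
    using st(1,2) disj by (auto simp: edge_vec_nth split: if_splits)
qed

lemma coef_add: "coef T t (x + y) = coef T t x + coef T t y"
  by (simp add: coef_def algebra_simps sum.distrib)

lemma coef_scaleR: "coef T t (c *\<^sub>R x) = c * coef T t x"
  by (simp add: coef_def algebra_simps sum_distrib_left)

lemma coef_linear: "linear (coef T t)"
  by (rule linearI) (simp_all add: coef_add coef_scaleR)

lemma coef_edge_vec:
  assumes "u \<in> E \<times> V"
  shows "coef T t (edge_vec u) = (if fst u \<in> cut T t then 1 else 0) - (if snd u \<in> cut T t then 1 else 0)"
  using assms disj by (auto simp: coef_eq edge_vec_nth sum.distrib sum.If_cases)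

subsection \<open>Spanning trees as bases\<close>

text \<open>Along an edge, the difference of the signed unit vectors is plus or minus the edge
  vector; along a path these differences telescope.\<close>

lemma path_in_span:
  assumes "T \<subseteq> E \<times> V" "(x, y) \<in> (T \<union> T\<inverse>)\<^sup>*"
  shows "sgn_vec $ x *\<^sub>R axis x 1 - sgn_vec $ y *\<^sub>R axis y 1 \<in> span (edge_vec ` T)"
  using assms(2)
proof (induction rule: rtrancl_induct)
  case base
  then show ?case by (simp add: span_zero)
next
  case (step y z)
  have "sgn_vec $ y *\<^sub>R axis y 1 - sgn_vec $ z *\<^sub>R axis z 1 \<in> span (edge_vec ` T)"
  proof (cases "(y, z) \<in> T")
    case True
    then have "edge_vec (y, z) \<in> span (edge_vec ` T)" and "y \<in> E" "z \<in> V"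
      using assms(1) by (auto intro: span_base)
    then show ?thesis
      by (simp add: edge_vec_def root_pt_def)
  next
    case False
    then have "(z, y) \<in> T" using step by auto
    then have "- edge_vec (z, y) \<in> span (edge_vec ` T)" and "z \<in> E" "y \<in> V"
      using assms(1) by (auto intro: span_base span_neg)
    moreover from this have "sgn_vec $ y *\<^sub>R axis y 1 - sgn_vec $ z *\<^sub>R axis z 1 = - edge_vec (z, y)"
      by (simp add: edge_vec_def root_pt_def)
    ultimately show ?thesis by simp
  qed
  from span_add[OF step.IH this] show ?case by simp
qed

text \<open>The signed coordinates of a vector in \<open>W\<close> sum to zero, so subtracting one
  reference vector at \<open>j\<close> from every signed unit vector does not change the
  combination.\<close>

lemma vec_expand:
  fixes x :: "real ^ 'a"
  assumes "x \<in> W"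
  shows "x = (\<Sum>i\<in>UNIV. (sgn_vec $ i * x $ i) *\<^sub>R (sgn_vec $ i *\<^sub>R axis i 1 - sgn_vec $ j *\<^sub>R axis j 1))"
proof -
  have sq: "(sgn_vec $ i * x $ i) *\<^sub>R (sgn_vec $ i *\<^sub>R axis i 1) = (x $ i) *\<^sub>R axis i (1::real)" for i
    using sgn_sq[of i] by (simp add: mult.commute mult.left_commute)
  have "(\<Sum>i\<in>UNIV. (sgn_vec $ i * x $ i) *\<^sub>R (sgn_vec $ i *\<^sub>R axis i 1 - sgn_vec $ j *\<^sub>R axis j 1))
    = (\<Sum>i\<in>UNIV. (sgn_vec $ i * x $ i) *\<^sub>R (sgn_vec $ i *\<^sub>R axis i 1)) - (\<Sum>i\<in>UNIV. sgn_vec $ i * x $ i) *\<^sub>R (sgn_vec $ j *\<^sub>R axis j 1)"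
    by (simp only: scaleR_right_diff_distrib sum_subtractf scaleR_sum_left)
  also have "(\<Sum>i\<in>UNIV. (sgn_vec $ i * x $ i) *\<^sub>R (sgn_vec $ i *\<^sub>R axis i 1)) = (\<Sum>i\<in>UNIV. (x $ i) *\<^sub>R axis i (1::real))"
    by (intro sum.cong refl sq)
  also have "(\<Sum>i\<in>UNIV. sgn_vec $ i * x $ i) = 0"
    using assms by (simp add: W_def inner_vec_def)
  also have "(\<Sum>i\<in>UNIV. (x $ i) *\<^sub>R axis i 1) = x"
    by (simp add: vec_eq_iff axis_def if_distrib cong: if_cong)
  finally show ?thesis by simp
qed

lemma connected_iff_span:
  assumes T: "T \<subseteq> E \<times> V"
  shows "connected_by (E \<union> V) T \<longleftrightarrow> span (edge_vec ` T) = W"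
proof
  assume c: "connected_by (E \<union> V) T"
  obtain j where "j \<in> E" using E_ne by auto
  have "x \<in> span (edge_vec ` T)" if "x \<in> W" for x
  proof (subst vec_expand[OF that, of j], intro span_sum span_scale path_in_span[OF T])
    show "(i, j) \<in> (T \<union> T\<inverse>)\<^sup>*" for i
      using c by (simp add: connected_by_def cover)
  qed
  then show "span (edge_vec ` T) = W"
    using span_edges_W[OF T] by auto
next
  assume s: "span (edge_vec ` T) = W"
  show "connected_by (E \<union> V) T"
    unfolding connected_by_def
  proof (intro ballI, rule ccontr)
    fix x y assume ne: "(x, y) \<notin> (T \<union> T\<inverse>)\<^sup>*"
    define C where "C = {z. (x, z) \<in> (T \<union> T\<inverse>)\<^sup>*}"
    have xC: "x \<in> C" and yC: "y \<notin> C" using ne by (auto simp: C_def)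
    have cl: "fst u \<in> C \<longleftrightarrow> snd u \<in> C" if "u \<in> T" for u
    proof -
      have "(fst u, snd u) \<in> T \<union> T\<inverse>" "(snd u, fst u) \<in> T \<union> T\<inverse>" using that by auto
      then show ?thesis unfolding C_def mem_Collect_eq by (meson rtrancl.rtrancl_into_rtrancl)
    qed
    \<comment> \<open>The signed indicator of the component of \<open>x\<close>. Each edge of
      \<open>T\<close> has both ends in \<open>C\<close> or none, so \<open>h\<close> annihilates
      all edge vectors, but not the difference of the signed unit vectors at \<open>x\<close> and
      \<open>y\<close>.\<close>
    define h where "h = (\<chi> i. if i \<in> C then sgn_vec $ i else 0)"
    have "edge_vec ` T \<subseteq> {z. h \<bullet> z = 0}"
    proof
      fix z assume "z \<in> edge_vec ` T"
      then obtain u where u: "u \<in> T" "z = edge_vec u" by auto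
      then have "fst u \<in> E" "snd u \<in> V" using T by auto
      then show "z \<in> {z. h \<bullet> z = 0}"
        using cl[OF u(1)] by (simp add: u h_def edge_vec_def root_pt_def inner_add_right inner_axis)
    qed
    then have "W \<subseteq> {z. h \<bullet> z = 0}"
      unfolding s[symmetric] by (intro span_minimal subspace_hyperplane)
    moreover have "sgn_vec $ x *\<^sub>R axis x 1 - sgn_vec $ y *\<^sub>R axis y 1 \<in> W"
      by (simp add: W_def inner_diff_right inner_axis sgn_sq)
    ultimately have "h \<bullet> (sgn_vec $ x *\<^sub>R axis x 1 - sgn_vec $ y *\<^sub>R axis y 1) = 0"
      by auto
    then show False
      using xC yC by (simp add: h_def inner_diff_right inner_axis sgn_sq)
  qed
qed

lemma connected_card:
  assumes T: "T \<subseteq> E \<times> V" and "connected_by (E \<union> V) T"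
  shows "CARD('a) - 1 \<le> card T"
proof -
  have "dim W \<le> card (edge_vec ` T)"
    using assms by (intro dim_le_card) (auto simp: connected_iff_span)
  also have "\<dots> \<le> card T" by (rule card_image_le) auto
  finally show ?thesis by (simp add: dim_W)
qed

lemma treeD:
  assumes "tree T"
  shows "T \<subseteq> Ed" "T \<subseteq> E \<times> V" "span (edge_vec ` T) = W"
  using assms Ed_sub connected_iff_span[of T] by (auto simp: spanning_tree_def)

text \<open>If the ends of \<open>t\<close> were still joined without \<open>t\<close>, every path
  could avoid \<open>t\<close>, against the minimality of the tree.\<close>

lemma tree_cut:
  assumes T: "tree T" and t: "t \<in> T"
  shows "snd t \<notin> cut T t"
proof
  let ?R = "((T - {t}) \<union> (T - {t})\<inverse>)\<^sup>*"
  assume "snd t \<in> cut T t"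
  then have *: "(fst t, snd t) \<in> ?R" by (simp add: cut_def)
  have sym: "sym ?R" by (intro sym_rtrancl sym_Un_converse)
  have "T \<union> T\<inverse> \<subseteq> ?R"
  proof
    fix p assume p: "p \<in> T \<union> T\<inverse>"
    show "p \<in> ?R"
    proof (cases "p = t \<or> p = (snd t, fst t)")
      case True
      then show ?thesis using * symD[OF sym *] by (cases t) auto
    next
      case False
      then have "p \<in> (T - {t}) \<union> (T - {t})\<inverse>" using p by (cases t) auto
      then show ?thesis by (rule r_into_rtrancl)
    qed
  qed
  then have "(T \<union> T\<inverse>)\<^sup>* \<subseteq> ?R" by (rule rtrancl_subset_rtrancl)
  then have "connected_by (E \<union> V) (T - {t})"
    using T by (auto simp: spanning_tree_def connected_by_def)
  then show False using T t by (auto simp: spanning_tree_def)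
qed

text \<open>Only \<open>t\<close> crosses its own cut. Any other tree edge has both ends on one
  side, where its two contributions cancel.\<close>

lemma coef_tree:
  assumes "tree T" "t \<in> T" "u \<in> T"
  shows "coef T t (edge_vec u) = (if u = t then 1 else 0)"
proof -
  have "u \<in> E \<times> V" using treeD(2)[OF assms(1)] assms(3) by auto
  then show ?thesis
    using cut_closed[of u T t] tree_cut[OF assms(1,2)] fst_in_cut[of t T] assms(3)
    by (cases "u = t") (auto simp: coef_edge_vec)
qed

lemma inj_tree: "tree T \<Longrightarrow> inj_on edge_vec T"
  using inj_edge_vec treeD(2) inj_on_subset by blast

lemma coef_combination:
  assumes "tree T" "F \<subseteq> T" "t \<in> T"
  shows "coef T t (\<Sum>u\<in>F. a u *\<^sub>R edge_vec u) = (if t \<in> F then a t else 0)"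
proof -
  have "coef T t (\<Sum>u\<in>F. a u *\<^sub>R edge_vec u) = (\<Sum>u\<in>F. a u * coef T t (edge_vec u))"
    by (simp add: linear_sum[OF coef_linear] coef_scaleR)
  also have "\<dots> = (\<Sum>u\<in>F. if u = t then a u else 0)"
    using assms by (intro sum.cong) (auto simp: coef_tree)
  finally show ?thesis by simp
qed

text \<open>Some combination exists because the edge vectors span \<open>W\<close>; the dual
  functionals read off its coefficients.\<close>

lemma tree_expand:
  assumes T: "tree T" and x: "x \<in> W"
  shows "x = (\<Sum>t\<in>T. coef T t x *\<^sub>R edge_vec t)"
proof -
  have "x \<in> span (edge_vec ` T)" using treeD(3)[OF T] x by simp
  then have "x \<in> range (\<lambda>a. \<Sum>z\<in>edge_vec ` T. a z *\<^sub>R z)"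
    by (subst (asm) span_finite) auto
  then obtain a where a: "x = (\<Sum>z\<in>edge_vec ` T. a z *\<^sub>R z)"
    by blast
  have x': "x = (\<Sum>t\<in>T. a (edge_vec t) *\<^sub>R edge_vec t)"
    unfolding a by (rule sum.reindex_cong[OF inj_tree[OF T]]) auto
  have "coef T t x = a (edge_vec t)" if "t \<in> T" for t
    using coef_combination[OF T subset_refl that, of "\<lambda>t. a (edge_vec t)"] that
    unfolding x'[symmetric] by simp
  then have "(\<Sum>t\<in>T. coef T t x *\<^sub>R edge_vec t) = (\<Sum>t\<in>T. a (edge_vec t) *\<^sub>R edge_vec t)"
    by (intro sum.cong) auto
  with x' show ?thesis by argo
qed

lemma tree_independent:
  assumes T: "tree T"
  shows "independent (edge_vec ` T)"
proof (rule independent_if_scalars_zero)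
  fix f z assume s: "(\<Sum>y\<in>edge_vec ` T. f y *\<^sub>R y) = 0" and "z \<in> edge_vec ` T"
  then obtain t where t: "t \<in> T" "z = edge_vec t" by auto
  have "(\<Sum>u\<in>T. f (edge_vec u) *\<^sub>R edge_vec u) = 0"
    using s sum.reindex[OF inj_tree[OF T], of "\<lambda>y. f y *\<^sub>R y"] by simp
  then show "f z = 0"
    using coef_combination[OF T subset_refl t(1), of "\<lambda>u. f (edge_vec u)"] t
    by (simp add: coef_def)
qed simp

lemma tree_card:
  assumes "tree T"
  shows "card T = CARD('a) - 1"
proof -
  have "card T = card (edge_vec ` T)"
    using card_image[OF inj_tree[OF assms]] by simp
  also have "\<dots> = dim W"
    using treeD(3)[OF assms] tree_independent[OF assms] dim_span_eq_card_independent by metis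
  finally show ?thesis by (simp add: dim_W)
qed

text \<open>By \<open>connected_card\<close> no connected edge set has fewer than
  \<open>dim W\<close> elements, so a spanning family of that size is minimal. This replaces
  minimality by a count.\<close>

lemma tree_iff: "tree T \<longleftrightarrow> T \<subseteq> Ed \<and> span (edge_vec ` T) = W \<and> card T = CARD('a) - 1"
proof
  assume r: "T \<subseteq> Ed \<and> span (edge_vec ` T) = W \<and> card T = CARD('a) - 1"
  then have T: "T \<subseteq> E \<times> V" using Ed_sub by auto
  have "\<not> connected_by (E \<union> V) (T - {t})" if "t \<in> T" for t
  proof
    assume "connected_by (E \<union> V) (T - {t})"
    then have "CARD('a) - 1 \<le> card (T - {t})" using T by (intro connected_card) auto
    moreover have "card (T - {t}) < card T" using that by (intro psubset_card_mono) auto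
    ultimately show False using r by simp
  qed
  then show "tree T" using r T by (simp add: spanning_tree_def connected_iff_span)
next
  assume "tree T"
  then show "T \<subseteq> Ed \<and> span (edge_vec ` T) = W \<and> card T = CARD('a) - 1"
    using treeD(1,3)[of T] tree_card[of T] by blast
qed

text \<open>Basis exchange: the expansion of the new edge over \<open>T\<close> must involve an edge
  outside \<open>T'\<close>, and that edge can be traded for it.\<close>

lemma tree_swap:
  assumes T: "tree T" and T': "tree T'" and u: "u \<in> T' - T"
  obtains t where "t \<in> T - T'" "tree (insert u (T - {t}))"
proof -
  have uW: "edge_vec u \<in> W" using u treeD(2)[OF T'] edge_vec_W by auto
  note ex = tree_expand[OF T uW]
  \<comment> \<open>Otherwise \<open>edge_vec u\<close> would be a combination of edges of
    \<open>T'\<close> other than \<open>u\<close>, on which the functional of \<open>u\<close> with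
    respect to \<open>T'\<close> vanishes.\<close>
  have "\<exists>t\<in>T - T'. coef T t (edge_vec u) \<noteq> 0"
  proof (rule ccontr)
    assume "\<not> ?thesis"
    then have "edge_vec u = (\<Sum>t\<in>T \<inter> T'. coef T t (edge_vec u) *\<^sub>R edge_vec t)"
      by (subst ex, intro sum.mono_neutral_right) auto
    also have "coef T' u \<dots> = 0"
      using u by (subst coef_combination[OF T']) auto
    finally show False
      using coef_tree[OF T', of u u] u by simp
  qed
  then obtain t where t: "t \<in> T" "t \<notin> T'" "coef T t (edge_vec u) \<noteq> 0" by auto
  let ?S = "insert u (T - {t})"
  let ?r = "\<Sum>s\<in>T - {t}. coef T s (edge_vec u) *\<^sub>R edge_vec s"
  have "edge_vec u - ?r = coef T t (edge_vec u) *\<^sub>R edge_vec t"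
    unfolding diff_eq_eq by (rule trans[OF ex sum.remove[OF finite t(1)]])
  moreover have y: "y = (1 / c) *\<^sub>R x" if "x = c *\<^sub>R y" "c \<noteq> 0" for c and x y :: "real ^ 'a"
    using that by simp
  ultimately have eq: "edge_vec t = (1 / coef T t (edge_vec u)) *\<^sub>R (edge_vec u - ?r)"
    using t(3) by blast
  have base: "edge_vec s \<in> span (edge_vec ` ?S)" if "s = u \<or> s \<in> T - {t}" for s
    using that by (intro span_base imageI) blast
  have "edge_vec t \<in> span (edge_vec ` ?S)"
    unfolding eq by (intro span_scale span_diff span_sum base) auto
  with base have "edge_vec ` T \<subseteq> span (edge_vec ` ?S)" by blast
  then have "W \<subseteq> span (edge_vec ` ?S)"
    unfolding treeD(3)[OF T, symmetric] by (intro span_minimal subspace_span)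
  moreover have S: "?S \<subseteq> Ed" using u treeD(1)[OF T] treeD(1)[OF T'] by blast
  moreover from S have "span (edge_vec ` ?S) \<subseteq> W" using Ed_sub by (intro span_edges_W) blast
  moreover have "card ?S = card T"
    using u card_Suc_Diff1[OF finite t(1)] by simp
  ultimately have S': "tree ?S"
    unfolding tree_iff tree_card[OF T] by (intro conjI subset_antisym)
  have "t \<in> T - T'" using t(1,2) by blast
  from that[OF this S'] show thesis .
qed

text \<open>The edge vectors of \<open>F\<close> are independent and lie in the coordinate space of
  \<open>C\<close>. A unit vector is outside \<open>W\<close>, so adding \<open>axis c 1\<close>
  keeps them independent, and one dimension is left over.\<close>

lemma forest_bound:
  assumes T: "tree T" and F: "F \<subseteq> T" "\<And>u. u \<in> F \<Longrightarrow> fst u \<in> C \<and> snd u \<in> C" and C: "c \<in> C"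
  shows "card F < card C"
proof -
  have F': "F \<subseteq> E \<times> V" using F(1) treeD(2)[OF T] by (rule subset_trans)
  have "axis c 1 \<notin> span (edge_vec ` F)"
  proof
    assume "axis c 1 \<in> span (edge_vec ` F)"
    then have "sgn_vec \<bullet> axis c 1 = 0" using span_edges_W[OF F'] by (auto simp: W_def)
    then show False using sgn_sq[of c] by (simp add: inner_axis)
  qed
  moreover have "independent (edge_vec ` F)"
    using tree_independent[OF T] F(1) by (meson dependent_mono image_mono)
  ultimately have ind: "independent (insert (axis c 1) (edge_vec ` F))"
    by (simp add: independent_insertI)
  have sub: "insert (axis c 1) (edge_vec ` F) \<subseteq> span ((\<lambda>i. axis i 1) ` C :: (real ^ 'a) set)"
    (is "_ \<subseteq> span ?B")
  proof -
    have "axis i 1 \<in> span ?B" if "i \<in> C" for i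
      using that by (intro span_base imageI)
    then show ?thesis
      using F(2) C by (auto simp: edge_vec_def root_pt_def intro: span_add)
  qed
  have "card (insert (axis c 1) (edge_vec ` F)) \<le> card ((\<lambda>i. axis i 1) ` C :: (real ^ 'a) set)"
    using independent_span_bound[OF _ ind sub] by simp
  also have "\<dots> \<le> card C" by (rule card_image_le) auto
  finally have "card (insert (axis c 1) (edge_vec ` F)) \<le> card C" .
  moreover have "card (edge_vec ` F) = card F"
    using inj_tree[OF T] F(1) by (meson card_image inj_on_subset)
  moreover have "card (insert (axis c 1) (edge_vec ` F)) = Suc (card (edge_vec ` F))"
    using \<open>axis c 1 \<notin> span (edge_vec ` F)\<close> span_base[of "axis c 1" "edge_vec ` F"]
    by (intro card_insert_disjoint finite_imageI finite notI) blast
  ultimately show ?thesis by simp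
qed

lemma cut_degree_sum:
  assumes T: "tree T" and t: "t \<in> T"
  shows "(\<Sum>e\<in>cut T t \<inter> E. deg T e) = card (cut T t)"
proof -
  let ?C = "cut T t"
  let ?A = "{u \<in> T - {t}. fst u \<in> ?C}" and ?B = "{u \<in> T - {t}. fst u \<notin> ?C}"
  have a: "card ?A < card ?C"
    by (rule forest_bound[OF T _ _ fst_in_cut]) (use cut_closed[of _ T t] in auto)
  have b: "card ?B < card (- ?C)"
    by (rule forest_bound[OF T, where c = "snd t"]) (use cut_closed[of _ T t] tree_cut[OF T t] in auto)
  have "?A \<union> ?B = T - {t}" "?A \<inter> ?B = {}" by auto
  then have "card ?A + card ?B = card (T - {t})"
    using card_Un_disjoint[of ?A ?B] by simp
  also have "\<dots> = CARD('a) - 2" using t tree_card[OF T] by simp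
  finally have ab: "card ?A + card ?B = CARD('a) - 2" .
  have "card ?C + card (- ?C) = CARD('a)"
    using card_Un_disjoint[of ?C "- ?C"] by simp
  \<comment> \<open>The two strict bounds add up to the total number of edges other than
    \<open>t\<close>, so both are attained.\<close>
  with a b ab have A: "card ?A + 1 = card ?C" by linarith
  \<comment> \<open>Besides the edges inside the cut, \<open>t\<close> is counted as well, since its
    \<open>E\<close>-end lies in the cut.\<close>
  have "{u \<in> T. fst u \<in> ?C \<inter> E} = insert t ?A"
    using t fst_in_cut treeD(2)[OF T] by auto
  then have "card {u \<in> T. fst u \<in> ?C \<inter> E} = card ?A + 1" by simp
  then show ?thesis using A by (simp add: sum_deg)
qed

lemma coord_E:
  assumes T: "tree T" and x: "x \<in> W" and e: "e \<in> E"
  shows "x $ e = (\<Sum>v | (e, v) \<in> T. coef T (e, v) x)"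
proof -
  have "x $ e = (\<Sum>t\<in>T. coef T t x * edge_vec t $ e)"
    by (subst tree_expand[OF T x]) (simp add: sum_component)
  also have "\<dots> = (\<Sum>t\<in>T. if fst t = e then coef T t x else 0)"
    using treeD(2)[OF T] e disj by (intro sum.cong) (auto simp: edge_vec_nth)
  also have "\<dots> = (\<Sum>t | t \<in> T \<and> fst t = e. coef T t x)"
    by (rule sum.inter_filter[symmetric]) simp
  finally show ?thesis by (simp only: sum_edges_at)
qed

lemma coord_V:
  assumes T: "tree T" and x: "x \<in> W" and v: "v \<in> V"
  shows "x $ v = (\<Sum>t | t \<in> T \<and> snd t = v. coef T t x)"
proof -
  have "x $ v = (\<Sum>t\<in>T. coef T t x * edge_vec t $ v)"
    by (subst tree_expand[OF T x]) (simp add: sum_component)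
  also have "\<dots> = (\<Sum>t\<in>T. if snd t = v then coef T t x else 0)"
    using treeD(2)[OF T] v disj by (intro sum.cong) (auto simp: edge_vec_nth)
  also have "\<dots> = (\<Sum>t | t \<in> T \<and> snd t = v. coef T t x)"
    by (rule sum.inter_filter[symmetric]) simp
  finally show ?thesis .
qed

text \<open>The vector of a pair \<open>(e, v)\<close> has coordinate 1 at \<open>e\<close>, which
  only tree edges at \<open>e\<close> can supply.\<close>

lemma tree_deg_pos:
  assumes T: "tree T" and e: "e \<in> E"
  shows "deg T e \<ge> 1"
proof (rule ccontr)
  assume "\<not> ?thesis"
  then have "card {v. (e, v) \<in> T} = 0" unfolding deg_def by linarith
  then have "{v. (e, v) \<in> T} = {}" by (simp only: card_0_eq finite)
  moreover obtain v where v: "v \<in> V" using V_ne by auto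
  ultimately have "edge_vec (e, v) $ e = 0"
    using coord_E[OF T edge_vec_W, of "(e, v)" e] e by simp
  then show False by (simp add: edge_vec_nth split: if_splits)
qed

lemma tree_deg_sum:
  assumes "tree T"
  shows "(\<Sum>e\<in>E. deg T e) = card E + card V - 1"
proof -
  have "{t \<in> T. fst t \<in> E} = T" using treeD(2)[OF assms] by auto
  then show ?thesis by (simp add: sum_deg tree_card[OF assms] card_nodes)
qed

end

context bipartite
begin

subsection \<open>Exchange of hypertrees\<close>

lemma hypertree_iff: "hypertree E V Ed f \<longleftrightarrow> (\<exists>T. tree T \<and> (\<forall>e\<in>E. deg T e = f e + 1))"
  by (simp add: hypertree_def deg_def)

lemma tree_hypertree: "tree T \<Longrightarrow> hypertree E V Ed (\<lambda>e. deg T e - 1)"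
  unfolding hypertree_iff using tree_deg_pos[of T] by (intro exI[of _ T]) force

lemma hypertree_cong: "(\<And>e. e \<in> E \<Longrightarrow> f e = g e) \<Longrightarrow> hypertree E V Ed f \<longleftrightarrow> hypertree E V Ed g"
  by (simp add: hypertree_iff)

lemma hypertree_sum:
  assumes "hypertree E V Ed f"
  shows "(\<Sum>e\<in>E. f e) = card V - 1"
proof -
  obtain T where T: "tree T" "\<And>e. e \<in> E \<Longrightarrow> deg T e = f e + 1"
    using assms by (auto simp: hypertree_iff)
  have "(\<Sum>e\<in>E. deg T e) = (\<Sum>e\<in>E. f e) + card E"
    using T(2) by (simp add: sum_Suc)
  then show ?thesis using tree_deg_sum[OF T(1)] card_pos by simp
qed

lemma deg_swap:
  fixes T :: "('a \<times> 'a) set"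
  assumes "u \<notin> T" "t \<in> T"
  shows "deg (insert u (T - {t})) x + of_bool (x = fst t) = deg T x + of_bool (x = fst u)"
proof -
  have 1: "deg (insert u S) x = deg S x + of_bool (x = fst u)" if "u \<notin> S"
    for u and S :: "('a \<times> 'a) set"
  proof (cases "x = fst u")
    case True
    then have "{v. (x, v) \<in> insert u S} = insert (snd u) {v. (x, v) \<in> S}" by (cases u) auto
    moreover have "snd u \<notin> {v. (x, v) \<in> S}" using that True by (cases u) auto
    ultimately show ?thesis
      unfolding deg_def using True card_insert_disjoint[OF finite, of "snd u" "{v. (x, v) \<in> S}"] by simp
  next
    case False
    then have "{v. (x, v) \<in> insert u S} = {v. (x, v) \<in> S}" by (cases u) auto
    then show ?thesis using False by (simp add: deg_def)
  qed
  have "deg (insert t (T - {t})) x = deg (T - {t}) x + of_bool (x = fst t)" by (rule 1) simp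
  then have "deg T x = deg (T - {t}) x + of_bool (x = fst t)" using assms by (simp add: insert_absorb)
  then show ?thesis using 1[of u "T - {t}"] assms by simp
qed

text \<open>A tree of degree vector \<open>f - 1\<^sub>a + 1\<^sub>b\<close> is moved towards \<open>T'\<close> by edge swaps
  at \<open>a\<close>; every swap keeps the shape of the degree vector and changes only the node \<open>a\<close>,
  until a node with \<open>f a > f' a\<close> is reached.\<close>
lemma exchange_step:
  assumes T': "tree T'" "\<And>x. x \<in> E \<Longrightarrow> deg T' x = f' x + 1"
    and b: "b \<in> E" "f b < f' b"
    and T: "tree T" "a \<in> E" "\<And>x. x \<in> E \<Longrightarrow> deg T x + of_bool (x = a) = f x + 1 + of_bool (x = b)"
  shows "\<exists>e\<in>E. f' e < f e \<and> hypertree E V Ed (f(e := f e - 1, b := f b + 1))"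
  using T
proof (induction "card (T' - T)" arbitrary: T a rule: less_induct)
  case less
  show ?case
  proof (cases "f' a < f a")
    case True
    then have "a \<noteq> b" using b by auto
    have "hypertree E V Ed (f(a := f a - 1, b := f b + 1))"
      unfolding hypertree_iff
    proof (intro exI[of _ T] conjI ballI)
      fix x assume "x \<in> E"
      then show "deg T x = (f(a := f a - 1, b := f b + 1)) x + 1"
        using less.prems(3)[of x] True \<open>a \<noteq> b\<close> by (auto split: if_splits)
    qed (fact less.prems(1))
    then show ?thesis using True less.prems(2) by blast
  next
    case False
    \<comment> \<open>For \<open>a = b\<close> the strictness comes from \<open>f b < f' b\<close>;
      otherwise it comes from the unit that \<open>T\<close> lacks at \<open>a\<close>. An edge of
      \<open>T'\<close> at \<open>a\<close> can therefore be swapped in, and the lack moves to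
      \<open>fst t\<close>.\<close>
    then have "deg T a < deg T' a"
      using less.prems(3)[OF less.prems(2)] T'(2)[OF less.prems(2)] b(2) by (cases "a = b") auto
    then have "\<not> {v. (a, v) \<in> T'} \<subseteq> {v. (a, v) \<in> T}"
      unfolding deg_def using card_mono[of "{v. (a, v) \<in> T}" "{v. (a, v) \<in> T'}"] by auto
    then obtain v where v: "(a, v) \<in> T' - T" by auto
    obtain t where t: "t \<in> T - T'" "tree (insert (a, v) (T - {t}))"
      using tree_swap[OF less.prems(1) T'(1) v] .
    show ?thesis
    proof (rule less.hyps[OF _ t(2)])
      show "card (T' - insert (a, v) (T - {t})) < card (T' - T)"
        using v t(1) by (intro psubset_card_mono) auto
      show "fst t \<in> E" using t(1) treeD(2)[OF less.prems(1)] by auto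
      fix x assume x: "x \<in> E"
      show "deg (insert (a, v) (T - {t})) x + of_bool (x = fst t) = f x + 1 + of_bool (x = b)"
        using deg_swap[of "(a, v)" T t x] v t(1) less.prems(3)[OF x] by simp
    qed
  qed
qed

text \<open>The exchange property of the bases of an integral polymatroid. Its transfers are those
  that define internal inactivity.\<close>

lemma hypertree_exchange:
  assumes "hypertree E V Ed f" "hypertree E V Ed f'" "b \<in> E" "f b < f' b"
  obtains e where "e \<in> E" "f' e < f e" "hypertree E V Ed (f(e := f e - 1, b := f b + 1))"
proof -
  obtain T where T: "tree T" "\<And>e. e \<in> E \<Longrightarrow> deg T e = f e + 1"
    using assms(1) by (auto simp: hypertree_iff)
  obtain T' where T': "tree T'" "\<And>e. e \<in> E \<Longrightarrow> deg T' e = f' e + 1"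
    using assms(2) by (auto simp: hypertree_iff)
  \<comment> \<open>With \<open>a = b\<close> the two indicator terms of
    \<open>exchange_step\<close> cancel, so a tree realising \<open>f\<close> is a valid
    start.\<close>
  have "\<exists>e\<in>E. f' e < f e \<and> hypertree E V Ed (f(e := f e - 1, b := f b + 1))"
    by (rule exchange_step[where T = T and a = b and f = f and f' = f', OF T' assms(3,4) T(1) assms(3)]) (simp_all add: T(2))
  then show thesis using that by blast
qed

lemma finite_hypertrees: "finite {f \<in> extensional E. hypertree E V Ed f}"
proof (rule finite_subset)
  show "{f \<in> extensional E. hypertree E V Ed f} \<subseteq> E \<rightarrow>\<^sub>E {..card V}"
  proof
    fix f assume "f \<in> {f \<in> extensional E. hypertree E V Ed f}"
    then have f: "f \<in> extensional E" "hypertree E V Ed f" by auto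
    have "f e \<le> card V" if "e \<in> E" for e
      using member_le_sum[of e E f] that hypertree_sum[OF f(2)] by simp
    then show "f \<in> E \<rightarrow>\<^sub>E {..card V}" using f(1) by (auto simp: PiE_def)
  qed
qed (simp add: finite_PiE)

text \<open>A maximiser of a weight that favours small hyperedges exists, and a transfer from an
  inactive hyperedge with slack would increase its weight. Two solutions are compared by an exchange
  at the least hyperedge where they differ.\<close>

lemma ex1_active_above:
  assumes r: "linear_order_on E r"
    and h: "hypertree E V Ed h" "\<And>e. e \<in> E \<Longrightarrow> g e \<le> h e"
  shows "\<exists>!f. f \<in> extensional E \<and> hypertree E V Ed f \<and> (\<forall>e\<in>E. g e \<le> f e) \<and>
      (\<forall>e\<in>E. internally_inactive r E V Ed f e \<longrightarrow> f e = g e)" (is "\<exists>!f. ?P f")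
proof -
  have r': "refl_on E r" "trans r" "antisym r" "total_on E r"
    using r by (auto simp: linear_order_on_def partial_order_on_def preorder_on_def)
  \<comment> \<open>The number of hyperedges at or above \<open>e\<close>, so that smaller
    hyperedges weigh more.\<close>
  define w where "w e = card {x \<in> E. (e, x) \<in> r}" for e
  have w: "w e < w e'" if "(e', e) \<in> r" "e' \<noteq> e" "e' \<in> E" "e \<in> E" for e e'
    unfolding w_def
  proof (rule psubset_card_mono)
    have "(e, e') \<notin> r" using that r'(3) by (auto dest: antisymD)
    moreover have "(e', e') \<in> r" using r'(1) that(3) by (auto dest: refl_onD)
    ultimately show "{x \<in> E. (e, x) \<in> r} \<subset> {x \<in> E. (e', x) \<in> r}"
      using that r'(2) by (auto dest: transD)
  qed simp
  define H where "H = {f \<in> extensional E. hypertree E V Ed f \<and> (\<forall>e\<in>E. g e \<le> f e)}"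
  define s where "s f = (\<Sum>e\<in>E. f e * w e)" for f
  have "finite H" unfolding H_def by (rule finite_subset[OF _ finite_hypertrees]) auto
  moreover have "restrict h E \<in> H"
    using h hypertree_cong[of "restrict h E" h] by (auto simp: H_def)
  ultimately obtain f where f: "f \<in> H" "\<And>f'. f' \<in> H \<Longrightarrow> s f' \<le> s f"
    using Max_in[of "s ` H"] Max_ge[of "s ` H"] by (metis (no_types, lifting) empty_iff finite_imageI imageE image_eqI)
  have "f e = g e" if e: "e \<in> E" and ina: "internally_inactive r E V Ed f e" for e
  proof (rule ccontr)
    assume ne: "f e \<noteq> g e"
    obtain e' where e': "e' \<in> E" "(e', e) \<in> r" "e' \<noteq> e" "f e \<ge> 1"
      "hypertree E V Ed (f(e := f e - 1, e' := f e' + 1))"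
      using ina by (auto simp: internally_inactive_def)
    let ?f = "f(e := f e - 1, e' := f e' + 1)"
    have "?f \<in> H"
      using f(1) e' e ne unfolding H_def
      by (auto simp: extensional_def)
    then have "s ?f \<le> s f" by (rule f(2))
    have rest: "(\<Sum>x\<in>E - {e} - {e'}. ?f x * w x) = (\<Sum>x\<in>E - {e} - {e'}. f x * w x)"
      by (rule sum.cong) auto
    have split: "s k = k e * w e + (k e' * w e' + (\<Sum>x\<in>E - {e} - {e'}. k x * w x))" for k
      unfolding s_def using e e' by (simp add: sum.remove[of E e] sum.remove[of "E - {e}" e'])
    have "s ?f = (f e - 1) * w e + ((f e' + 1) * w e' + (\<Sum>x\<in>E - {e} - {e'}. f x * w x))"
      using split[of ?f] rest e'(3) by simp
    moreover have "f e * w e = (f e - 1) * w e + w e"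
      using e'(4) by (cases "f e") auto
    ultimately have "s ?f > s f"
      using split[of f] w[OF e'(2,3,1) e] by simp
    then show False using \<open>s ?f \<le> s f\<close> by simp
  qed
  then have ex: "?P f" using f(1) by (auto simp: H_def)
  \<comment> \<open>The exchange moves a unit of \<open>f1\<close> from some \<open>e\<close> to the
    smaller \<open>b\<close>, so \<open>e\<close> is inactive for \<open>f1\<close> and
    \<open>f1 e = g e\<close>. This contradicts \<open>g e <= f2 e < f1 e\<close>.\<close>
  have no: False
    if P: "?P f1" "?P f2" and b: "b \<in> E" "f1 b < f2 b"
      and m: "\<And>x. x \<in> E \<Longrightarrow> f1 x \<noteq> f2 x \<Longrightarrow> (b, x) \<in> r" for f1 f2 b
  proof -
    obtain e where e: "e \<in> E" "f2 e < f1 e" "hypertree E V Ed (f1(e := f1 e - 1, b := f1 b + 1))"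
      using hypertree_exchange[of f1 f2 b] P b by blast
    then have "internally_inactive r E V Ed f1 e"
      unfolding internally_inactive_def using m[of e] b by (intro bexI[of _ b]) auto
    then have "f1 e = g e" using P(1) e(1) by blast
    moreover have "g e \<le> f2 e" using P(2) e(1) by blast
    ultimately show False using e(2) by simp
  qed
  have uniq: "f1 = f2" if P: "?P f1" "?P f2" for f1 f2
  proof (rule ccontr)
    assume "f1 \<noteq> f2"
    define D where "D = {x \<in> E. f1 x \<noteq> f2 x}"
    have "D \<noteq> {}"
      using \<open>f1 \<noteq> f2\<close> P extensionalityI[of f1 E f2] by (auto simp: D_def)
    \<comment> \<open>Maximal weight singles out the least element of \<open>D\<close> with respect
      to \<open>r\<close>.\<close>
    then obtain b where b': "b \<in> D" "Max (w ` D) = w b"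
      using obtains_MAX[of D w] by auto
    have b: "b \<in> D" "\<And>x. x \<in> D \<Longrightarrow> w x \<le> w b"
      using b'(1) Max_ge[of "w ` D"] by (auto simp flip: b'(2))
    have m: "(b, x) \<in> r" if "x \<in> E" "f1 x \<noteq> f2 x" for x
    proof (rule ccontr)
      assume nr: "(b, x) \<notin> r"
      then have "b \<noteq> x" using r'(1) that by (auto dest: refl_onD)
      then have "(x, b) \<in> r" using nr r'(4) that b(1) by (auto simp: total_on_def D_def)
      then have "w b < w x" using w \<open>b \<noteq> x\<close> that b(1) by (auto simp: D_def)
      then show False using b(2)[of x] that by (auto simp: D_def)
    qed
    show False
    proof (cases "f1 b < f2 b")
      case True
      then show False using no[OF P _ True] b(1) m by (auto simp: D_def)
    next
      case False
      then have "f2 b < f1 b" using b(1) by (auto simp: D_def)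
      moreover have "(b, x) \<in> r" if "x \<in> E" "f2 x \<noteq> f1 x" for x
        using m[OF that(1)] that(2) by simp
      ultimately show False using no[OF P(2,1)] b(1) by (auto simp: D_def)
    qed
  qed
  show ?thesis using ex uniq by blast
qed

subsection \<open>The hypertree point\<close>

text \<open>The sign pattern of the coordinates of this point in the basis given by a spanning tree
  compares the hypertree \<open>f\<close> with the hypertree of the spanning tree. The summand \<open>1 / |E|\<close>
  makes the point generic.\<close>
definition hpoint :: "('a \<Rightarrow> nat) \<Rightarrow> real ^ 'a" where
  "hpoint f = (\<chi> i. (if i \<in> E then real (f i) + 1 / card E else 1) / card V)"

text \<open>The coefficient at \<open>t\<close> of the vector that is
  \<open>deg T e - 1 - f e\<close> on \<open>E\<close> and zero on \<open>V\<close>. For a spanning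
  tree it is the flow through \<open>t\<close> that carries this difference along the tree.\<close>

definition excess :: "('a \<times> 'a) set \<Rightarrow> ('a \<Rightarrow> nat) \<Rightarrow> 'a \<times> 'a \<Rightarrow> int" where
  "excess T f t = (\<Sum>e\<in>cut T t \<inter> E. int (deg T e) - 1 - int (f e))"

lemma hpoint_nth:
  "i \<in> E \<Longrightarrow> hpoint f $ i = (real (f i) + 1 / card E) / card V"
  "i \<in> V \<Longrightarrow> hpoint f $ i = 1 / card V"
  using disj by (auto simp: hpoint_def)

lemma hpoint_sums:
  assumes "(\<Sum>e\<in>E. f e) = card V - 1"
  shows "(\<Sum>i\<in>E. hpoint f $ i) = 1" "(\<Sum>i\<in>V. hpoint f $ i) = 1"
proof -
  have "(\<Sum>i\<in>E. hpoint f $ i) = (real (\<Sum>e\<in>E. f e) + 1) / card V"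
    using E_ne V_ne by (simp add: hpoint_nth add_divide_distrib sum.distrib sum_divide_distrib)
  also have "\<dots> = 1" using assms card_pos V_ne by (simp add: of_nat_diff)
  finally show "(\<Sum>i\<in>E. hpoint f $ i) = 1" .
  show "(\<Sum>i\<in>V. hpoint f $ i) = 1" using V_ne by (simp add: hpoint_nth)
qed

lemma hpoint_W: "(\<Sum>e\<in>E. f e) = card V - 1 \<Longrightarrow> hpoint f \<in> W"
  by (simp add: W_def inner_sgn hpoint_sums)

text \<open>\<open>cut_degree_sum\<close> expresses the number of \<open>V\<close>-nodes in the cut
  by degrees, which turns the \<open>E\<close>-sum minus the \<open>V\<close>-sum into an excess
  plus a fraction.\<close>

lemma coef_hpoint:
  assumes T: "tree T" and t: "t \<in> T"
  shows "coef T t (hpoint f) = (card (cut T t \<inter> E) / card E - excess T f t) / card V"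
proof -
  let ?C = "cut T t"
  have "card ?C = card (?C \<inter> E) + card (?C \<inter> V)"
    using card_Un_disjoint[of "?C \<inter> E" "?C \<inter> V"] disj cover
    by (simp add: Int_Un_distrib[symmetric] Int_assoc inf_left_commute)
  then have "(\<Sum>e\<in>?C \<inter> E. real (deg T e)) = card (?C \<inter> E) + card (?C \<inter> V)"
    using cut_degree_sum[OF T t] by (metis of_nat_sum)
  then have "excess T f t = real (card (?C \<inter> V)) - (\<Sum>e\<in>?C \<inter> E. real (f e))"
    by (simp add: excess_def sum_subtractf)
  moreover have "(\<Sum>i\<in>?C \<inter> E. hpoint f $ i) = ((\<Sum>e\<in>?C \<inter> E. real (f e)) + card (?C \<inter> E) / card E) / card V"
    by (simp add: hpoint_nth add_divide_distrib sum.distrib sum_divide_distrib)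
  moreover have "(\<Sum>i\<in>?C \<inter> V. hpoint f $ i) = card (?C \<inter> V) / card V"
    by (simp add: hpoint_nth)
  ultimately show ?thesis
    by (simp add: coef_eq diff_divide_distrib add_divide_distrib)
qed

text \<open>The excess is an integer and the fraction lies strictly above 0 and at most at 1, so
  only the fraction 1 could make the coordinate vanish.\<close>

lemma coef_hpoint_sign:
  assumes T: "tree T" and t: "t \<in> T" and f: "(\<Sum>e\<in>E. f e) = card V - 1"
  shows "coef T t (hpoint f) < 0 \<longleftrightarrow> excess T f t \<ge> 1"
    and "coef T t (hpoint f) > 0 \<longleftrightarrow> excess T f t \<le> 0"
proof -
  let ?a = "card (cut T t \<inter> E) / card E"
  have "fst t \<in> cut T t \<inter> E" using t treeD(2)[OF T] fst_in_cut[of t T] by auto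
  then have "card (cut T t \<inter> E) > 0" by (auto simp only: card_gt_0_iff finite)
  then have a0: "?a > 0" using card_pos by simp
  have a1: "?a \<le> 1" using card_pos card_mono[of E "cut T t \<inter> E"] by simp
  have k0: "?a - real_of_int (excess T f t) > 0" if "excess T f t \<le> 0"
    using a0 that by (intro less_le_trans[OF a0]) simp
  have k1: "?a - real_of_int (excess T f t) \<le> 0" if "\<not> excess T f t \<le> 0"
  proof -
    have "real_of_int (excess T f t) \<ge> 1" using that by simp
    then show ?thesis using a1 by linarith
  qed
  \<comment> \<open>The fraction 1 means that the cut contains all of \<open>E\<close>. Then the
    excess is the difference of the total sums, which is zero.\<close>
  have a2: "?a - real_of_int (excess T f t) < 0" if "excess T f t \<ge> 1"
  proof (rule ccontr)
    assume "\<not> ?thesis"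
    moreover have "real_of_int (excess T f t) \<ge> 1" using that by simp
    ultimately have "\<not> ?a < 1" by linarith
    then have "card E \<le> card (cut T t \<inter> E)" using card_pos by (simp add: field_simps)
    then have "cut T t \<inter> E = E" by (intro card_seteq) auto
    then have "excess T f t = int (\<Sum>e\<in>E. deg T e) - card E - int (\<Sum>e\<in>E. f e)"
      by (simp add: excess_def sum_subtractf)
    then show False using that f tree_deg_sum[OF T] card_pos by simp
  qed
  have V: "real (card V) > 0" using card_pos by simp
  show "coef T t (hpoint f) < 0 \<longleftrightarrow> excess T f t \<ge> 1"
    unfolding coef_hpoint[OF T t] divide_less_0_iff using V a2 k0 by force
  show "coef T t (hpoint f) > 0 \<longleftrightarrow> excess T f t \<le> 0"
    unfolding coef_hpoint[OF T t] zero_less_divide_iff using V k1 k0 by force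
qed

text \<open>The excesses are the tree coordinates of \<open>z\<close>; its entries give the net
  outflow at \<open>e\<close> and conservation at \<open>v\<close>.\<close>

lemma excess_balance:
  assumes T: "tree T" and f: "(\<Sum>e\<in>E. f e) = card V - 1"
  shows "e \<in> E \<Longrightarrow> (\<Sum>v | (e, v) \<in> T. excess T f (e, v)) = int (deg T e) - 1 - int (f e)"
    and "v \<in> V \<Longrightarrow> (\<Sum>t | t \<in> T \<and> snd t = v. excess T f t) = 0"
proof -
  define z :: "real ^ 'a" where "z = (\<chi> i. if i \<in> E then real (deg T i) - 1 - real (f i) else 0)"
  have zE: "z $ i = real (deg T i) - 1 - real (f i)" if "i \<in> E" for i using that by (simp add: z_def)
  have zV: "z $ i = 0" if "i \<in> V" for i using that disj by (auto simp: z_def)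
  have "(\<Sum>i\<in>E. z $ i) = real (\<Sum>e\<in>E. deg T e) - card E - real (\<Sum>e\<in>E. f e)"
    by (simp add: zE sum_subtractf)
  also have "\<dots> = 0" using f tree_deg_sum[OF T] card_pos by (simp add: of_nat_diff)
  finally have z: "z \<in> W" by (simp add: W_def inner_sgn zV)
  have c: "coef T t z = excess T f t" for t
    by (simp add: coef_eq zE zV excess_def)
  show "(\<Sum>v | (e, v) \<in> T. excess T f (e, v)) = int (deg T e) - 1 - int (f e)" if "e \<in> E"
    using coord_E[OF T z that] that unfolding c zE[OF that] of_int_sum[symmetric] by linarith
  show "(\<Sum>t | t \<in> T \<and> snd t = v. excess T f t) = 0" if "v \<in> V"
    using coord_V[OF T z that] that unfolding c zV[OF that] of_int_sum[symmetric] by linarith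
qed

text \<open>Viewed as a flow on the tree the excess has a source; it is found by minimising the cut
  among the edges of positive excess.\<close>
lemma excess_source:
  assumes T: "tree T" and f: "(\<Sum>e\<in>E. f e) = card V - 1"
    and ne: "e0 \<in> E" "deg T e0 \<noteq> f e0 + 1"
  obtains e v where "(e, v) \<in> T" "excess T f (e, v) \<ge> 1" "\<And>u. (e, u) \<in> T \<Longrightarrow> excess T f (e, u) \<ge> 0"
proof -
  have TEV: "T \<subseteq> E \<times> V" by (rule treeD(2)[OF T])
  \<comment> \<open>By conservation at a \<open>V\<close>-node, a negative edge is balanced there by
    a positive one.\<close>
  have pos: "\<exists>s\<in>T. snd s = snd t \<and> excess T f s \<ge> 1" if t: "t \<in> T" "excess T f t < 0" for t
  proof (rule ccontr)
    assume no: "\<not> ?thesis"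
    have "snd t \<in> V" using t TEV by auto
    have "(\<Sum>s | s \<in> T \<and> snd s = snd t. excess T f s) < (\<Sum>s | s \<in> T \<and> snd s = snd t. 0)"
    proof (rule sum_strict_mono_ex1)
      show "\<exists>s\<in>{s \<in> T. snd s = snd t}. excess T f s < 0" using t by (intro bexI[of _ t]) auto
    qed (use no in force)+
    then show False using excess_balance(2)[OF T f \<open>snd t \<in> V\<close>] by simp
  qed
  have "\<exists>t\<in>T. excess T f t \<noteq> 0"
  proof (rule ccontr)
    assume "\<not> ?thesis"
    then have "(\<Sum>v | (e0, v) \<in> T. excess T f (e0, v)) = 0" by (intro sum.neutral) auto
    then show False using excess_balance(1)[OF T f ne(1)] ne(2) by simp
  qed
  then have "\<exists>t. t \<in> T \<and> excess T f t \<ge> 1" using pos by force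
  then obtain t where t: "t \<in> T" "excess T f t \<ge> 1"
    and min: "\<And>s. s \<in> T \<Longrightarrow> excess T f s \<ge> 1 \<Longrightarrow> card (cut T t) \<le> card (cut T s)"
    using ex_has_least_nat[of "\<lambda>t. t \<in> T \<and> excess T f t \<ge> 1" _ "\<lambda>t. card (cut T t)"] by blast
  have "excess T f (fst t, u) \<ge> 0" if u: "(fst t, u) \<in> T" for u
  proof (rule ccontr)
    assume "\<not> ?thesis"
    then have neg: "excess T f (fst t, u) < 0" by simp
    then obtain s where s: "s \<in> T" "snd s = u" "excess T f s \<ge> 1" using pos[OF u] by auto
    have ut: "(fst t, u) \<noteq> t" and us: "(fst t, u) \<noteq> s" using neg t s by auto
    have "u \<in> cut T t" using cut_closed[OF u ut] fst_in_cut[of t T] by simp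
    have "u \<notin> cut T s" using tree_cut[OF T s(1)] s(2) by simp
    then have nf: "fst t \<notin> cut T s" using cut_closed[OF u us] by simp
    have "s \<noteq> t" using nf fst_in_cut[of s T] by auto
    \<comment> \<open>The component of \<open>s\<close> is reached from \<open>fst t\<close> only
      through \<open>u\<close>. It therefore lies inside the cut of \<open>t\<close> and misses
      \<open>fst t\<close>, which contradicts the minimal choice of \<open>t\<close>.\<close>
    have "cut T s \<subseteq> cut T s \<inter> cut T t"
    proof (rule cut_least)
      have "fst s \<in> cut T t" using cut_closed[OF s(1) \<open>s \<noteq> t\<close>] s(2) \<open>u \<in> cut T t\<close> by simp
      then show "fst s \<in> cut T s \<inter> cut T t" using fst_in_cut[of s T] by simp
      fix x assume x: "x \<in> T" "x \<noteq> s"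
      show "fst x \<in> cut T s \<inter> cut T t \<longleftrightarrow> snd x \<in> cut T s \<inter> cut T t"
        using cut_closed[OF x] cut_closed[OF x(1), of t] nf tree_cut[OF T t(1)]
        by (cases "x = t") auto
    qed
    then have "cut T s \<subset> cut T t" using nf fst_in_cut[of t T] by auto
    then have "card (cut T s) < card (cut T t)" by (intro psubset_card_mono) auto
    then show False using min[OF s(1,3)] by simp
  qed
  then show thesis using that[of "fst t" "snd t"] t by simp
qed

text \<open>Omitting such an edge from a tree gives a facet whose hyperplane separates the simplex
  from \<open>hpoint f\<close>. These are the edges that a half-open simplex may drop.\<close>

definition neg_edges :: "('a \<times> 'a) set \<Rightarrow> ('a \<Rightarrow> nat) \<Rightarrow> ('a \<times> 'a) set" where
  "neg_edges T f = {t \<in> T. coef T t (hpoint f) < 0}"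

text \<open>At a source no excess is negative and every negative edge has excess at least 1, so
  their number is bounded by the outflow \<open>deg T e - 1 - f e\<close>.\<close>

lemma neg_edges_source:
  assumes T: "tree T" and f: "(\<Sum>e\<in>E. f e) = card V - 1"
    and ne: "e0 \<in> E" "deg T e0 \<noteq> f e0 + 1"
  obtains t where "t \<in> neg_edges T f" "card {v. (fst t, v) \<in> neg_edges T f} + f (fst t) + 1 \<le> deg T (fst t)"
proof -
  obtain e v where e: "(e, v) \<in> T" "excess T f (e, v) \<ge> 1" "\<And>u. (e, u) \<in> T \<Longrightarrow> excess T f (e, u) \<ge> 0"
    using excess_source[OF assms] by metis
  have neg: "t \<in> neg_edges T f \<longleftrightarrow> t \<in> T \<and> excess T f t \<ge> 1" for t
    using coef_hpoint_sign(1)[OF T _ f, of t] by (auto simp: neg_edges_def)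
  have eE: "e \<in> E" using e(1) treeD(2)[OF T] by auto
  have "int (card {v. (e, v) \<in> neg_edges T f}) = (\<Sum>v | (e, v) \<in> neg_edges T f. 1)" by simp
  also have "\<dots> \<le> (\<Sum>v | (e, v) \<in> neg_edges T f. excess T f (e, v))"
    by (rule sum_mono) (auto simp: neg)
  also have "\<dots> \<le> (\<Sum>v | (e, v) \<in> T. excess T f (e, v))"
    by (rule sum_mono2) (auto simp: neg e(3))
  also have "\<dots> = int (deg T e) - 1 - int (f e)" by (rule excess_balance(1)[OF T f eE])
  finally have "card {v. (e, v) \<in> neg_edges T f} + f e + 1 \<le> deg T e" by linarith
  then show thesis using that[of "(e, v)"] e(1,2) neg by simp
qed

lemma coef_hpoint_pos:
  assumes T: "tree T" and f: "\<And>e. e \<in> E \<Longrightarrow> deg T e = f e + 1" and t: "t \<in> T"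
  shows "coef T t (hpoint f) > 0"
proof -
  have "hypertree E V Ed f" using T f by (auto simp: hypertree_iff)
  moreover have "excess T f t = 0" using f by (simp add: excess_def)
  ultimately show ?thesis using coef_hpoint_sign(2)[OF T t hypertree_sum] by simp
qed

end

section \<open>Small steps away from a point\<close>

lemma eventually_step_sign:
  fixes a b :: real
  shows "\<forall>\<^sub>F \<epsilon> in at_right 0. (0 < a \<longrightarrow> 0 < (1 + \<epsilon>) * a - \<epsilon> * b) \<and> (a < 0 \<longrightarrow> (1 + \<epsilon>) * a - \<epsilon> * b < 0)"
proof -
  have lim: "((\<lambda>\<epsilon>. (1 + \<epsilon>) * a - \<epsilon> * b) \<longlongrightarrow> a) (at_right 0)"
    by (auto intro!: tendsto_eq_intros)
  show ?thesis
    using order_tendstoD(1)[OF lim, of 0] order_tendstoD(2)[OF lim, of 0]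
    by (cases a "0::real" rule: linorder_cases) simp_all
qed

text \<open>A relative interior point allows one prolongation beyond it inside \<open>Q\<close>;
  convexity gives all shorter ones.\<close>

lemma rel_interior_step:
  fixes Q :: "'n::euclidean_space set"
  assumes "convex Q" "x \<in> rel_interior Q" "q \<in> Q"
  shows "\<forall>\<^sub>F \<epsilon> in at_right 0. (1 + \<epsilon>) *\<^sub>R x - \<epsilon> *\<^sub>R q \<in> Q"
proof -
  have "Q \<noteq> {}" using assms(3) by auto
  then obtain e where e: "e > 1" "(1 - e) *\<^sub>R q + e *\<^sub>R x \<in> Q"
    using assms convex_rel_interior_iff[of Q x] by blast
  have "\<forall>\<^sub>F \<epsilon> in at_right 0. \<epsilon> \<in> {0<..<e - 1}"
    using e(1) by (intro eventually_at_right_real) simp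
  then show ?thesis
  proof (rule eventually_mono)
    fix \<epsilon> assume \<epsilon>: "\<epsilon> \<in> {0<..<e - 1}"
    define s where "s = \<epsilon> / (e - 1)"
    have s: "0 \<le> s" "s \<le> 1" "s * (e - 1) = \<epsilon>"
      using \<epsilon> e(1) by (auto simp: s_def)
    have "(1 - s) *\<^sub>R x + s *\<^sub>R ((1 - e) *\<^sub>R q + e *\<^sub>R x) \<in> Q"
      using convexD_alt[OF assms(1) _ e(2)] rel_interior_subset assms(2) s by blast
    also have "(1 - s) *\<^sub>R x + s *\<^sub>R ((1 - e) *\<^sub>R q + e *\<^sub>R x)
      = (1 + s * (e - 1)) *\<^sub>R x - (s * (e - 1)) *\<^sub>R q"
      by (simp add: algebra_simps)
    finally show "(1 + \<epsilon>) *\<^sub>R x - \<epsilon> *\<^sub>R q \<in> Q" by (simp add: s)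
  qed
qed

context bipartite
begin

subsection \<open>Simplices of trees\<close>

abbreviation Q :: "(real ^ 'a) set" where
  "Q \<equiv> root_polytope Ed"

abbreviation face :: "('a \<times> 'a) set \<Rightarrow> (real ^ 'a) set" where
  "face F \<equiv> convex hull (edge_vec ` F)"

text \<open>Every generating point has height 1, so inside \<open>W\<close> the equation
  \<open>height x = 1\<close> describes the affine hull of \<open>Q\<close>. For a vector of
  \<open>W\<close> the height is also the sum of its tree coordinates.\<close>

definition height :: "real ^ 'a \<Rightarrow> real" where
  "height x = (\<Sum>i\<in>E. x $ i)"

lemma Q_eq: "Q = face Ed"
  unfolding root_polytope_def edge_vec_def by (rule arg_cong[where f = "\<lambda>S. convex hull S"]) force

lemma height_linear: "linear height"
  by (rule linearI) (simp_all add: height_def sum.distrib sum_distrib_left)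

lemma height_edge_vec: "t \<in> E \<times> V \<Longrightarrow> height (edge_vec t) = 1"
  using disj by (auto simp: height_def edge_vec_nth sum.distrib sum.If_cases)

lemma height_combination:
  assumes "F \<subseteq> E \<times> V"
  shows "height (\<Sum>t\<in>F. a t *\<^sub>R edge_vec t) = (\<Sum>t\<in>F. a t)"
  unfolding linear_sum[OF height_linear]
  by (rule sum.cong) (use assms in \<open>auto simp: linear_scale[OF height_linear] height_edge_vec\<close>)

lemma combination_W:
  assumes "F \<subseteq> E \<times> V"
  shows "(\<Sum>t\<in>F. a t *\<^sub>R edge_vec t) \<in> W"
  using assms by (intro subspace_sum subspace_W subspace_scale edge_vec_W) auto

lemma sum_coef:
  assumes "tree T" "x \<in> W"
  shows "(\<Sum>t\<in>T. coef T t x) = height x"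
  using height_combination[OF treeD(2)[OF assms(1)]] tree_expand[OF assms] by metis

lemma in_face_iff:
  assumes "F \<subseteq> E \<times> V"
  shows "x \<in> face F \<longleftrightarrow> (\<exists>a. (\<forall>t\<in>F. 0 \<le> a t) \<and> sum a F = 1 \<and> x = (\<Sum>t\<in>F. a t *\<^sub>R edge_vec t))"
proof -
  have inj: "inj_on edge_vec F" using inj_edge_vec assms by (rule inj_on_subset)
  show ?thesis
  proof
    assume "x \<in> face F"
    then obtain u where "\<forall>y\<in>edge_vec ` F. 0 \<le> u y" "sum u (edge_vec ` F) = 1"
      "x = (\<Sum>y\<in>edge_vec ` F. u y *\<^sub>R y)"
      by (auto simp: convex_hull_finite)
    then show "\<exists>a. (\<forall>t\<in>F. 0 \<le> a t) \<and> sum a F = 1 \<and> x = (\<Sum>t\<in>F. a t *\<^sub>R edge_vec t)"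
      by (intro exI[of _ "u \<circ> edge_vec"]) (simp add: sum.reindex[OF inj])
  next
    assume "\<exists>a. (\<forall>t\<in>F. 0 \<le> a t) \<and> sum a F = 1 \<and> x = (\<Sum>t\<in>F. a t *\<^sub>R edge_vec t)"
    then obtain a where a: "\<forall>t\<in>F. 0 \<le> a t" "sum a F = 1" "x = (\<Sum>t\<in>F. a t *\<^sub>R edge_vec t)" by blast
    have "(\<Sum>t\<in>F. a t *\<^sub>R edge_vec t) \<in> face F"
      using a by (intro convex_sum) (auto intro: hull_inc)
    then show "x \<in> face F" using a(3) by simp
  qed
qed

lemma in_tree_face_iff:
  assumes T: "tree T" and F: "F \<subseteq> T"
  shows "x \<in> face F \<longleftrightarrow> x \<in> W \<and> height x = 1 \<and> (\<forall>t\<in>T. 0 \<le> coef T t x) \<and> (\<forall>t\<in>T - F. coef T t x = 0)"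
proof
  have FEV: "F \<subseteq> E \<times> V" using F treeD(2)[OF T] by (rule subset_trans)
  {
    assume "x \<in> face F"
    then obtain a where a: "\<forall>t\<in>F. 0 \<le> a t" "sum a F = 1" and x: "x = (\<Sum>t\<in>F. a t *\<^sub>R edge_vec t)"
      using in_face_iff[OF FEV] by auto
    show "x \<in> W \<and> height x = 1 \<and> (\<forall>t\<in>T. 0 \<le> coef T t x) \<and> (\<forall>t\<in>T - F. coef T t x = 0)"
      unfolding x using a by (simp add: combination_W[OF FEV] height_combination[OF FEV] coef_combination[OF T F])
  }
  assume r: "x \<in> W \<and> height x = 1 \<and> (\<forall>t\<in>T. 0 \<le> coef T t x) \<and> (\<forall>t\<in>T - F. coef T t x = 0)"
  then have xW: "x \<in> W" by simp
  have "(\<Sum>t\<in>F. coef T t x) = (\<Sum>t\<in>T. coef T t x)"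
    using F r by (intro sum.mono_neutral_left) auto
  then have "(\<Sum>t\<in>F. coef T t x) = 1" using sum_coef[OF T xW] r by simp
  moreover have "(\<Sum>t\<in>F. coef T t x *\<^sub>R edge_vec t) = (\<Sum>t\<in>T. coef T t x *\<^sub>R edge_vec t)"
    using F r by (intro sum.mono_neutral_left) auto
  then have "x = (\<Sum>t\<in>F. coef T t x *\<^sub>R edge_vec t)" using tree_expand[OF T xW] by argo
  ultimately show "x \<in> face F"
    unfolding in_face_iff[OF FEV] using r F by (intro exI[of _ "\<lambda>t. coef T t x"]) auto
qed

text \<open>The points lie on the hyperplane of height 1, which misses the origin, so the affine
  dimension is one below the linear one.\<close>

lemma aff_dim_face:
  assumes "F \<subseteq> E \<times> V"
  shows "aff_dim (face F) = int (dim (edge_vec ` F)) - 1"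
proof -
  let ?a = "(\<chi> i. if i \<in> E then 1 else 0) :: real ^ 'a"
  have a: "?a \<bullet> x = height x" for x
  proof -
    have "?a \<bullet> x = (\<Sum>i\<in>UNIV. if i \<in> E then x $ i else 0)"
      by (simp add: inner_vec_def) (rule sum.cong, auto)
    then show ?thesis by (simp add: height_def sum.If_cases)
  qed
  have "edge_vec ` F \<subseteq> {x. ?a \<bullet> x = 1}"
    using assms height_edge_vec unfolding a by blast
  then have "affine hull (edge_vec ` F) \<subseteq> {x. ?a \<bullet> x = 1}"
    by (intro hull_minimal affine_hyperplane)
  then have "0 \<notin> affine hull (edge_vec ` F)" by auto
  then have "aff_dim (insert 0 (edge_vec ` F)) = aff_dim (edge_vec ` F) + 1"
    by (simp add: aff_dim_insert)
  moreover have "aff_dim (insert 0 (edge_vec ` F)) = int (dim (insert 0 (edge_vec ` F)))"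
    by (intro aff_dim_zero hull_inc) simp
  moreover have "dim (insert 0 (edge_vec ` F)) = dim (edge_vec ` F)"
    by (metis dim_span span_insert_0)
  ultimately show ?thesis by (simp add: aff_dim_convex_hull)
qed

lemma aff_dim_Q: "aff_dim Q = int CARD('a) - 2"
proof -
  have "span (edge_vec ` Ed) = W" using conn connected_iff_span[OF Ed_sub] by simp
  then have "dim (edge_vec ` Ed) = CARD('a) - 1" by (metis dim_span dim_W)
  then show ?thesis
    unfolding Q_eq aff_dim_face[OF Ed_sub] using card_nodes card_pos by simp
qed

lemma dim_forest:
  assumes "tree T" "F \<subseteq> T"
  shows "dim (edge_vec ` F) = card F"
proof -
  have "independent (edge_vec ` F)"
    using tree_independent[OF assms(1)] assms(2) by (meson dependent_mono image_mono)
  then have "dim (edge_vec ` F) = card (edge_vec ` F)" by (rule dim_eq_card_independent)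
  also have "\<dots> = card F" using inj_tree[OF assms(1)] assms(2) by (meson card_image inj_on_subset)
  finally show ?thesis .
qed

lemma aff_dim_forest:
  assumes "tree T" "F \<subseteq> T"
  shows "aff_dim (face F) = int (card F) - 1"
  using aff_dim_face[of F] dim_forest[OF assms] assms treeD(2)[OF assms(1)] by auto

lemma face_mono: "F \<subseteq> G \<Longrightarrow> face F \<subseteq> face G"
  by (intro hull_mono image_mono)

text \<open>The simplex of a spanning tree has the affine hull of \<open>Q\<close>, so its relative
  interior is contained in that of \<open>Q\<close>.\<close>

lemma tree_interior_point:
  assumes T: "tree T" and x: "x \<in> W" "height x = 1" "\<And>t. t \<in> T \<Longrightarrow> 0 < coef T t x"
  shows "x \<in> rel_interior Q"
proof -
  have sub: "face T \<subseteq> Q" unfolding Q_eq using treeD(1)[OF T] by (rule face_mono)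
  have "aff_dim (face T) = aff_dim Q"
    using aff_dim_forest[OF T subset_refl] tree_card[OF T] aff_dim_Q card_nodes card_pos by simp
  then have "affine hull face T = affine hull Q"
    using sub aff_dim_eq_full_gen by (metis aff_dim_affine_hull)
  then have "rel_interior (face T) \<subseteq> rel_interior Q"
    using sub by (intro subset_rel_interior)
  moreover have "x \<in> rel_interior (face T)"
  proof -
    have "\<not> affine_dependent (edge_vec ` T)"
      using tree_independent[OF T] affine_dependent_imp_dependent by blast
    moreover have "\<exists>u. (\<forall>y\<in>edge_vec ` T. 0 < u y) \<and> sum u (edge_vec ` T) = 1 \<and> (\<Sum>y\<in>edge_vec ` T. u y *\<^sub>R y) = x"
    proof (intro exI conjI)
      let ?u = "\<lambda>y. coef T (inv_into T edge_vec y) x"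
      note inj = inj_tree[OF T]
      show "\<forall>y\<in>edge_vec ` T. 0 < ?u y" using x(3) inj by simp
      show "sum ?u (edge_vec ` T) = 1"
        using sum_coef[OF T x(1)] x(2) by (simp add: sum.reindex[OF inj] inj cong: sum.cong)
      show "(\<Sum>y\<in>edge_vec ` T. ?u y *\<^sub>R y) = x"
        using tree_expand[OF T x(1)] by (simp add: sum.reindex[OF inj] inj cong: sum.cong)
    qed
    ultimately show ?thesis by (simp add: rel_interior_convex_hull_explicit)
  qed
  ultimately show ?thesis by blast
qed

end

subsection \<open>Half-open decomposition of a triangulation\<close>

locale triangulated = bipartite E V Ed for E V :: "'a::finite set" and Ed +
  fixes \<T> :: "(real ^ 'a) set set"
  assumes tri: "triangulation Q \<T>"
begin

text \<open>Simplices are encoded by edge sets instead of point sets, which makes the tree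
  coordinates available.\<close>

definition max_trees :: "('a \<times> 'a) set set" where
  "max_trees = {T. T \<subseteq> Ed \<and> edge_vec ` T \<in> \<T>}"

text \<open>The empty face is excluded by the second condition, because its hull is empty.\<close>

definition inner_faces :: "('a \<times> 'a) set set" where
  "inner_faces = {F. (\<exists>T\<in>max_trees. F \<subseteq> T) \<and> \<not> face F \<subseteq> rel_frontier Q}"

lemma triangulationD:
  "\<tau> \<in> \<T> \<Longrightarrow> \<tau> \<subseteq> {x. x extreme_point_of Q}"
  "\<tau> \<in> \<T> \<Longrightarrow> \<not> affine_dependent \<tau>"
  "\<tau> \<in> \<T> \<Longrightarrow> aff_dim (convex hull \<tau>) = aff_dim Q"
  "\<tau> \<in> \<T> \<Longrightarrow> \<tau>' \<in> \<T> \<Longrightarrow> convex hull \<tau> \<inter> convex hull \<tau>' = convex hull (\<tau> \<inter> \<tau>')"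
  "\<Union> ((\<lambda>\<tau>. convex hull \<tau>) ` \<T>) = Q"
  using tri unfolding triangulation_def by blast+

lemma simplex_max_tree:
  assumes "\<tau> \<in> \<T>"
  obtains T where "T \<in> max_trees" "\<tau> = edge_vec ` T"
proof -
  have "\<tau> \<subseteq> edge_vec ` Ed"
    using triangulationD(1)[OF assms] extreme_point_of_convex_hull unfolding Q_eq by blast
  then obtain T where "T \<subseteq> Ed" "\<tau> = edge_vec ` T"
    by (meson subset_image_iff)
  then show thesis using assms that by (auto simp: max_trees_def)
qed

text \<open>Full dimension makes the edge vectors span \<open>W\<close>, and affine independence
  gives the right number of edges.\<close>

lemma max_tree:
  assumes "T \<in> max_trees"
  shows "tree T"
proof -
  have T: "T \<subseteq> Ed" "edge_vec ` T \<in> \<T>" using assms by (auto simp: max_trees_def)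
  then have TEV: "T \<subseteq> E \<times> V" using Ed_sub by blast
  have inj: "inj_on edge_vec T" using inj_edge_vec TEV by (rule inj_on_subset)
  have ad: "aff_dim (face T) = int CARD('a) - 2"
    using triangulationD(3)[OF T(2)] aff_dim_Q by simp
  then have d: "dim (edge_vec ` T) = CARD('a) - 1"
    using aff_dim_face[OF TEV] by linarith
  have "int (card (edge_vec ` T)) = aff_dim (face T) + 1"
    using aff_dim_affine_independent[OF triangulationD(2)[OF T(2)]] by (simp add: aff_dim_convex_hull)
  then have "card T = CARD('a) - 1"
    using ad card_image[OF inj] by linarith
  moreover have "span (edge_vec ` T) = W"
    using span_edges_W[OF TEV] d dim_W subspace_W by (intro subspace_dim_equal) (auto simp: subspace_span)
  ultimately show ?thesis using T(1) by (simp add: tree_iff)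
qed

lemma max_tree_subset: "T \<in> max_trees \<Longrightarrow> T \<subseteq> E \<times> V"
  using max_tree treeD(2) by blast

lemma face_in_Q: "T \<in> max_trees \<Longrightarrow> F \<subseteq> T \<Longrightarrow> face F \<subseteq> Q"
  unfolding Q_eq max_trees_def by (intro face_mono) auto

lemma Q_covered:
  assumes "x \<in> Q"
  obtains T where "T \<in> max_trees" "x \<in> face T"
proof -
  have "x \<in> \<Union> ((\<lambda>\<tau>. convex hull \<tau>) ` \<T>)" using assms unfolding triangulationD(5) .
  then obtain \<tau> where "\<tau> \<in> \<T>" "x \<in> convex hull \<tau>" by blast
  then show thesis using simplex_max_tree[of \<tau>] that by metis
qed

lemma face_Int:
  assumes "T \<in> max_trees" "T' \<in> max_trees"
  shows "face T \<inter> face T' = face (T \<inter> T')"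
proof -
  have "edge_vec ` T \<in> \<T>" "edge_vec ` T' \<in> \<T>" using assms by (auto simp: max_trees_def)
  then have "face T \<inter> face T' = convex hull (edge_vec ` T \<inter> edge_vec ` T')" by (rule triangulationD(4))
  also have "edge_vec ` T \<inter> edge_vec ` T' = edge_vec ` (T \<inter> T')"
    using inj_on_image_Int[OF inj_edge_vec max_tree_subset[OF assms(1)] max_tree_subset[OF assms(2)]] by simp
  finally show ?thesis .
qed

text \<open>The common point lies in the face of \<open>T \<inter> T'\<close>, so its coordinates at
  all other edges of \<open>T\<close> vanish.\<close>

lemma support_subset:
  assumes T: "T \<in> max_trees" "T' \<in> max_trees" and x: "x \<in> face T" "x \<in> face T'"
    and F: "F \<subseteq> T" "\<And>t. t \<in> F \<Longrightarrow> coef T t x \<noteq> 0"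
  shows "F \<subseteq> T'"
proof -
  have "x \<in> face (T \<inter> T')" using x face_Int[OF T] by blast
  then have "\<forall>t\<in>T - T \<inter> T'. coef T t x = 0"
    using in_tree_face_iff[OF max_tree[OF T(1)], of "T \<inter> T'"] by blast
  then show ?thesis using F by blast
qed

definition barycenter :: "('a \<times> 'a) set \<Rightarrow> real ^ 'a" where
  "barycenter F = (\<Sum>t\<in>F. (1 / card F) *\<^sub>R edge_vec t)"

lemma coef_barycenter:
  assumes "tree T" "F \<subseteq> T" "t \<in> T"
  shows "coef T t (barycenter F) = (if t \<in> F then 1 / card F else 0)"
  unfolding barycenter_def by (rule coef_combination[OF assms])

lemma barycenter_face:
  assumes "F \<subseteq> E \<times> V" "F \<noteq> {}"
  shows "barycenter F \<in> face F"
  unfolding in_face_iff[OF assms(1)] barycenter_def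
  using assms(2) by (intro exI[of _ "\<lambda>_. 1 / card F"]) (simp add: card_gt_0_iff)

lemma convex_Q: "convex Q"
  unfolding root_polytope_def by (rule convex_convex_hull)

text \<open>If the face contains a relative interior point \<open>z\<close> of \<open>Q\<close>, the
  segment from \<open>z\<close> to the barycenter can be prolonged within the face to
  \<open>w\<close>, and the barycenter lies strictly between \<open>z\<close> and
  \<open>w\<close>.\<close>

lemma inner_iff_barycenter:
  assumes T: "T \<in> max_trees" and F: "F \<subseteq> T" "F \<noteq> {}"
  shows "\<not> face F \<subseteq> rel_frontier Q \<longleftrightarrow> barycenter F \<in> rel_interior Q"
proof
  have FEV: "F \<subseteq> E \<times> V" using F(1) max_tree_subset[OF T] by blast
  show "\<not> face F \<subseteq> rel_frontier Q" if "barycenter F \<in> rel_interior Q"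
    using that barycenter_face[OF FEV F(2)] by (auto simp: rel_frontier_def)
  assume "\<not> face F \<subseteq> rel_frontier Q"
  then obtain z where z: "z \<in> face F" "z \<notin> rel_frontier Q" by blast
  have "z \<in> Q" using z(1) face_in_Q[OF T F(1)] by blast
  then have zi: "z \<in> rel_interior Q"
    using z(2) closure_subset[of Q] by (auto simp: rel_frontier_def)
  obtain a where a: "\<forall>t\<in>F. 0 \<le> a t" "sum a F = 1" "z = (\<Sum>t\<in>F. a t *\<^sub>R edge_vec t)"
    using z(1) in_face_iff[OF FEV] by auto
  define m where "m = real (card F)"
  have m: "m \<ge> 1" using F(2) by (simp add: m_def Suc_le_eq card_gt_0_iff)
  \<comment> \<open>The coefficients of the barycenter moved away from \<open>z\<close> by the
    factor \<open>1 / m\<close>; they stay nonnegative because \<open>a t <= 1\<close>.\<close>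
  define b where "b t = (1 + 1 / m) / m - a t / m" for t
  define w where "w = (\<Sum>t\<in>F. b t *\<^sub>R edge_vec t)"
  have "w \<in> face F"
    unfolding in_face_iff[OF FEV]
  proof (intro exI[of _ b] conjI ballI)
    show "0 \<le> b t" if "t \<in> F" for t
    proof -
      have "a t \<le> 1" using a(1,2) that member_le_sum[of t F a] by simp
      moreover have "0 \<le> 1 / m" using m by simp
      ultimately have "a t \<le> 1 + 1 / m" by linarith
      then have "a t / m \<le> (1 + 1 / m) / m" using m by (intro divide_right_mono) auto
      then show ?thesis by (simp add: b_def)
    qed
    have "sum b F = m * ((1 + 1 / m) / m) - sum a F / m"
      by (simp add: b_def sum_subtractf m_def sum_divide_distrib)
    then show "sum b F = 1" using m a(2) by simp
  qed (rule w_def)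
  then have wQ: "w \<in> Q" using face_in_Q[OF T F(1)] by blast
  have w: "w = (1 + 1 / m) *\<^sub>R barycenter F - (1 / m) *\<^sub>R z"
    unfolding w_def barycenter_def a(3) b_def m_def[symmetric]
    by (simp add: scaleR_left_diff_distrib sum_subtractf scaleR_sum_right)
  \<comment> \<open>The solution of \<open>(1 - e) * (1 + 1 / m) = 1\<close>, which recovers the
    barycenter from \<open>w\<close> and \<open>z\<close>.\<close>
  define e where "e = 1 / (m + 1)"
  have e: "0 < e" "e \<le> 1" "(1 - e) * (1 + 1 / m) = 1" "(1 - e) * (1 / m) = e"
  proof -
    have "m + m * m \<noteq> 0" using m mult_pos_pos[of m m] by linarith
    then show "0 < e" "e \<le> 1" "(1 - e) * (1 + 1 / m) = 1" "(1 - e) * (1 / m) = e"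
      using m by (simp_all add: e_def field_simps)
  qed
  have "w - e *\<^sub>R (w - z) = (1 - e) *\<^sub>R w + e *\<^sub>R z"
    by (simp add: algebra_simps)
  also have "\<dots> = ((1 - e) * (1 + 1 / m)) *\<^sub>R barycenter F - ((1 - e) * (1 / m)) *\<^sub>R z + e *\<^sub>R z"
    unfolding w by (simp only: scaleR_right_diff_distrib scaleR_scaleR)
  also have "\<dots> = barycenter F" unfolding e(3,4) by simp
  finally have "w - e *\<^sub>R (w - z) = barycenter F" .
  then show "barycenter F \<in> rel_interior Q"
    using rel_interior_convex_shrink[OF convex_Q zi wQ e(1,2)] by simp
qed

section \<open>Moving away from a generic interior point\<close>

context
  fixes q :: "real ^ 'a"
  assumes q: "q \<in> rel_interior Q" and generic: "\<And>T t. T \<in> max_trees \<Longrightarrow> t \<in> T \<Longrightarrow> coef T t q \<noteq> 0"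
begin

definition step :: "real ^ 'a \<Rightarrow> real \<Rightarrow> real ^ 'a" where
  "step x \<epsilon> = (1 + \<epsilon>) *\<^sub>R x - \<epsilon> *\<^sub>R q"

lemma q_Q: "q \<in> Q" and q_W: "q \<in> W" and height_q: "height q = 1"
proof -
  show "q \<in> Q" using q rel_interior_subset by blast
  then obtain T where "T \<in> max_trees" "q \<in> face T" by (rule Q_covered)
  then show "q \<in> W" "height q = 1" using in_tree_face_iff[OF max_tree subset_refl] by blast+
qed

lemma coef_step: "coef T t (step x \<epsilon>) = (1 + \<epsilon>) * coef T t x - \<epsilon> * coef T t q"
  by (simp add: step_def linear_diff[OF coef_linear] coef_scaleR)

lemma step_W: "x \<in> W \<Longrightarrow> step x \<epsilon> \<in> W"
  unfolding step_def by (intro subspace_diff subspace_scale subspace_W q_W)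

lemma height_step: "height x = 1 \<Longrightarrow> height (step x \<epsilon>) = 1"
  by (simp add: step_def linear_diff[OF height_linear] linear_scale[OF height_linear] height_q)

lemma eventually_step:
  "\<forall>\<^sub>F \<epsilon> in at_right 0. \<epsilon> > 0 \<and> (\<forall>T\<in>max_trees. \<forall>t\<in>T.
     (0 < coef T t x \<longrightarrow> 0 < coef T t (step x \<epsilon>)) \<and> (coef T t x < 0 \<longrightarrow> coef T t (step x \<epsilon>) < 0))"
  unfolding coef_step
  by (intro eventually_conj eventually_ball_finite ballI eventually_step_sign eventually_at_right_less) auto

text \<open>On \<open>F\<close> the barycenter has positive coordinates, which survive the step. Off
  \<open>F\<close> they are zero, and moving away from a negative coordinate of \<open>q\<close>
  makes them positive.\<close>

lemma step_pos:
  assumes "T \<in> max_trees" "F \<subseteq> T" "F \<noteq> {}" "T - F \<subseteq> {t. coef T t q < 0}" "\<epsilon> > 0"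
    and "\<And>t. t \<in> T \<Longrightarrow> 0 < coef T t (barycenter F) \<Longrightarrow> 0 < coef T t (step (barycenter F) \<epsilon>)"
  shows "t \<in> T \<Longrightarrow> 0 < coef T t (step (barycenter F) \<epsilon>)"
    and "step (barycenter F) \<epsilon> \<in> face T"
proof -
  note T = max_tree[OF assms(1)]
  have FEV: "F \<subseteq> E \<times> V" using assms(2) treeD(2)[OF T] by blast
  have pos: "0 < coef T t (step (barycenter F) \<epsilon>)" if t: "t \<in> T" for t
  proof (cases "t \<in> F")
    case True
    then have "0 < coef T t (barycenter F)"
      using assms(3) by (simp add: coef_barycenter[OF T assms(2) t] card_gt_0_iff)
    then show ?thesis by (rule assms(6)[OF t])
  next
    case False
    then have "coef T t q < 0" using assms(4) t by blast
    then show ?thesis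
      using False assms(5) by (simp add: coef_step coef_barycenter[OF T assms(2) t] mult_less_0_iff)
  qed
  then show "t \<in> T \<Longrightarrow> 0 < coef T t (step (barycenter F) \<epsilon>)" .
  have "barycenter F \<in> W" "height (barycenter F) = 1"
    using barycenter_face[OF FEV assms(3)] in_tree_face_iff[OF T assms(2)] by blast+
  then show "step (barycenter F) \<epsilon> \<in> face T"
    unfolding in_tree_face_iff[OF T subset_refl] using pos
    by (auto simp: step_W height_step less_imp_le)
qed

text \<open>The coordinates of \<open>q\<close> sum to 1, so they cannot all be negative.\<close>

lemma half_open_nonempty:
  assumes "T \<in> max_trees" "F \<subseteq> T" "T - F \<subseteq> {t. coef T t q < 0}"
  shows "F \<noteq> {}"
proof
  assume "F = {}"
  then have "(\<Sum>t\<in>T. coef T t q) \<le> 0" using assms(3) by (intro sum_nonpos) (auto simp: less_imp_le)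
  then show False using sum_coef[OF max_tree[OF assms(1)] q_W] height_q by simp
qed

text \<open>The barycenter lies strictly between the interior point \<open>q\<close> and a stepped
  point that is still in \<open>Q\<close>.\<close>

lemma half_open_inner:
  assumes T: "T \<in> max_trees" "F \<subseteq> T" "T - F \<subseteq> {t. coef T t q < 0}"
  shows "F \<in> inner_faces"
proof -
  let ?x = "barycenter F"
  have ne: "F \<noteq> {}" by (rule half_open_nonempty[OF assms])
  obtain \<epsilon> where \<epsilon>: "\<epsilon> > 0"
    "\<And>t. t \<in> T \<Longrightarrow> 0 < coef T t ?x \<Longrightarrow> 0 < coef T t (step ?x \<epsilon>)"
    using eventually_happens[OF eventually_step[of ?x]] T(1) by auto
  have yQ: "step ?x \<epsilon> \<in> Q"
    using step_pos(2)[OF T(1,2) ne T(3) \<epsilon>] face_in_Q[OF T(1) subset_refl] by blast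
  define e where "e = \<epsilon> / (1 + \<epsilon>)"
  have e: "0 < e" "e \<le> 1" "(1 - e) * (1 + \<epsilon>) = 1" "(1 - e) * \<epsilon> = e"
    using \<epsilon>(1) by (simp_all add: e_def field_simps)
  have "step ?x \<epsilon> - e *\<^sub>R (step ?x \<epsilon> - q) = (1 - e) *\<^sub>R step ?x \<epsilon> + e *\<^sub>R q"
    by (simp add: algebra_simps)
  also have "\<dots> = ((1 - e) * (1 + \<epsilon>)) *\<^sub>R ?x - ((1 - e) * \<epsilon>) *\<^sub>R q + e *\<^sub>R q"
    unfolding step_def by (simp only: scaleR_right_diff_distrib scaleR_scaleR)
  also have "\<dots> = ?x" unfolding e(3,4) by simp
  finally have "?x \<in> rel_interior Q"
    using rel_interior_convex_shrink[OF convex_Q q yQ e(1,2)] by simp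
  then show ?thesis
    using inner_iff_barycenter[OF T(1,2) ne] T(1,2) by (auto simp: inner_faces_def)
qed

text \<open>The simplex is the one that contains the barycenter of \<open>F\<close> after a small
  step away from \<open>q\<close>.\<close>

lemma inner_half_open:
  assumes F: "F \<in> inner_faces"
  shows "\<exists>!T. T \<in> max_trees \<and> F \<subseteq> T \<and> T - F \<subseteq> {t. coef T t q < 0}"
proof -
  let ?x = "barycenter F"
  obtain T0 where T0: "T0 \<in> max_trees" "F \<subseteq> T0" and nf: "\<not> face F \<subseteq> rel_frontier Q"
    using F by (auto simp: inner_faces_def)
  have ne: "F \<noteq> {}" using nf by auto
  have FEV: "F \<subseteq> E \<times> V" using T0 max_tree_subset by blast
  have xi: "?x \<in> rel_interior Q" using inner_iff_barycenter[OF T0 ne] nf by blast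
  have xF: "?x \<in> face F" by (rule barycenter_face[OF FEV ne])
  then have xW: "?x \<in> W" "height ?x = 1" using in_tree_face_iff[OF max_tree[OF T0(1)] T0(2)] by blast+
  have "\<forall>\<^sub>F \<epsilon> in at_right 0. step ?x \<epsilon> \<in> Q"
    unfolding step_def by (rule rel_interior_step[OF convex_Q xi q_Q])
  from eventually_happens[OF eventually_conj[OF this eventually_step[of ?x]]]
  obtain \<epsilon> where yQ: "step ?x \<epsilon> \<in> Q" and \<epsilon>: "\<epsilon> > 0"
    and pos: "\<And>T t. T \<in> max_trees \<Longrightarrow> t \<in> T \<Longrightarrow> 0 < coef T t ?x \<Longrightarrow> 0 < coef T t (step ?x \<epsilon>)"
    and neg: "\<And>T t. T \<in> max_trees \<Longrightarrow> t \<in> T \<Longrightarrow> coef T t ?x < 0 \<Longrightarrow> coef T t (step ?x \<epsilon>) < 0"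
    by auto
  obtain T where T: "T \<in> max_trees" "step ?x \<epsilon> \<in> face T" using yQ by (rule Q_covered)
  note tT = max_tree[OF T(1)]
  have y0: "0 \<le> coef T t (step ?x \<epsilon>)" if "t \<in> T" for t
    using T(2) in_tree_face_iff[OF tT subset_refl] that by blast
  \<comment> \<open>A negative coordinate would have stayed negative after the step. Hence the
    unmoved barycenter is in the same simplex.\<close>
  have "0 \<le> coef T t ?x" if "t \<in> T" for t
    using neg[OF T(1) that] y0[OF that] by linarith
  then have xT: "?x \<in> face T"
    using xW in_tree_face_iff[OF tT subset_refl] by blast
  have FT: "F \<subseteq> T"
  proof (rule support_subset[OF T0(1) T(1) _ xT T0(2)])
    show "?x \<in> face T0" using xF face_mono[OF T0(2)] by blast
    show "coef T0 t ?x \<noteq> 0" if "t \<in> F" for t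
      using that T0(2) ne by (subst coef_barycenter[OF max_tree[OF T0(1)] T0(2)]) auto
  qed
  \<comment> \<open>Off \<open>F\<close> the stepped coordinate is \<open>-\<epsilon>\<close> times
    that of \<open>q\<close>, so the latter is at most zero; genericity excludes zero.\<close>
  have ex: "T - F \<subseteq> {t. coef T t q < 0}"
  proof
    fix t assume t: "t \<in> T - F"
    then have "coef T t ?x = 0" by (subst coef_barycenter[OF tT FT]) auto
    then have "\<epsilon> * coef T t q \<le> 0" using y0[of t] t by (simp add: coef_step)
    then have "coef T t q \<le> 0" using \<epsilon> by (simp add: mult_le_0_iff)
    then show "t \<in> {t. coef T t q < 0}" using generic[OF T(1), of t] t by simp
  qed
  have half: "(\<forall>t\<in>T'. 0 < coef T' t (step ?x \<epsilon>)) \<and> step ?x \<epsilon> \<in> face T'"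
    if "T' \<in> max_trees" "F \<subseteq> T'" "T' - F \<subseteq> {t. coef T' t q < 0}" for T'
    using step_pos[OF that(1,2) ne that(3) \<epsilon>] pos[OF that(1)] by blast
  \<comment> \<open>The stepped point has only positive coordinates in both trees, so its support is
    each of them.\<close>
  have sub: "T1 \<subseteq> T2" if "T1 \<in> max_trees" "F \<subseteq> T1" "T1 - F \<subseteq> {t. coef T1 t q < 0}"
    "T2 \<in> max_trees" "F \<subseteq> T2" "T2 - F \<subseteq> {t. coef T2 t q < 0}" for T1 T2
  proof (rule support_subset[OF that(1,4), where x = "step ?x \<epsilon>"])
    show "step ?x \<epsilon> \<in> face T1" "step ?x \<epsilon> \<in> face T2"
      using half[OF that(1-3)] half[OF that(4-6)] by blast+
    show "coef T1 t (step ?x \<epsilon>) \<noteq> 0" if "t \<in> T1" for t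
      using half[OF \<open>T1 \<in> max_trees\<close> \<open>F \<subseteq> T1\<close> \<open>T1 - F \<subseteq> {t. coef T1 t q < 0}\<close>] that by force
  qed simp
  show ?thesis
  proof (rule ex1I)
    show "T \<in> max_trees \<and> F \<subseteq> T \<and> T - F \<subseteq> {t. coef T t q < 0}" using T(1) FT ex by blast
    show "T' = T" if "T' \<in> max_trees \<and> F \<subseteq> T' \<and> T' - F \<subseteq> {t. coef T' t q < 0}" for T'
      using sub[of T T'] sub[of T' T] that T(1) FT ex by blast
  qed
qed

end

end

subsection \<open>Signed counting\<close>

lemma card_ex1:
  assumes "\<exists>!x. P x"
  shows "card {x. P x} = 1"
proof -
  from assms obtain x where x: "P x" and uniq: "\<forall>y. P y \<longrightarrow> y = x" by (rule ex1E)
  have "y \<in> {x. P x} \<longleftrightarrow> y \<in> {x}" for y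
    unfolding mem_Collect_eq singleton_iff using x uniq by iprover
  then have "{x. P x} = {x}" by (rule set_eqI)
  then show ?thesis by simp
qed

text \<open>Inserting or removing \<open>t\<close> pairs the sets with opposite signs.\<close>

lemma sum_sign_toggle:
  assumes fin: "finite \<R>" "\<And>R. R \<in> \<R> \<Longrightarrow> finite R"
    and toggle: "\<And>R. t \<notin> R \<Longrightarrow> insert t R \<in> \<R> \<longleftrightarrow> R \<in> \<R>"
  shows "(\<Sum>R\<in>\<R>. (-1) ^ card R) = (0 :: int)"
proof -
  let ?A = "{R \<in> \<R>. t \<notin> R}"
  have inj: "inj_on (insert t) ?A" by (auto simp: inj_on_def)
  have "\<R> - ?A = insert t ` ?A"
  proof (intro subset_antisym subsetI)
    fix R assume "R \<in> \<R> - ?A"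
    then have "R = insert t (R - {t})" "R - {t} \<in> ?A"
      using toggle[of "R - {t}"] by (auto simp: insert_absorb)
    then show "R \<in> insert t ` ?A" by blast
  qed (use toggle in auto)
  then have "(\<Sum>R\<in>\<R> - ?A. (-1) ^ card R) = (\<Sum>R\<in>?A. (-1) ^ card (insert t R) :: int)"
    by (simp add: sum.reindex[OF inj])
  also have "\<dots> = - (\<Sum>R\<in>?A. (-1) ^ card R)"
    using fin(2) by (simp flip: sum_negf)
  finally show ?thesis
    using sum.subset_diff[of ?A \<R> "\<lambda>R. (-1) ^ card R :: int"] fin(1) by simp
qed

text \<open>The sums over up-sets are triangular in the fibre cardinalities.\<close>
lemma fibre_card_eq:
  fixes p :: "'x \<Rightarrow> 'd::order" and q :: "'y \<Rightarrow> 'd" and c :: "'d \<Rightarrow> nat"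
  assumes fin: "finite X" "finite Y"
    and eq: "\<And>g. (\<Sum>x | x \<in> X \<and> g \<le> p x. (-1) ^ c (p x)) = (\<Sum>y | y \<in> Y \<and> g \<le> q y. (-1) ^ c (q y) :: int)"
  shows "card {x \<in> X. p x = d} = card {y \<in> Y. q y = d}"
proof -
  define D where "D = p ` X \<union> q ` Y"
  have finD: "finite D" using fin by (simp add: D_def)
  have out: "card {x \<in> X. p x = d} = card {y \<in> Y. q y = d}" if "d \<notin> D" for d
  proof -
    have "{x \<in> X. p x = d} = {}" "{y \<in> Y. q y = d} = {}" using that by (auto simp: D_def)
    then show ?thesis by (simp only: card.empty)
  qed
  have fibres: "(\<Sum>x | x \<in> X \<and> g \<le> p x. (-1) ^ c (p x)) = (\<Sum>d | d \<in> D \<and> g \<le> d. (-1) ^ c d * int (card {x \<in> X. p x = d}))"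
    if "finite X" "p ` X \<subseteq> D" for X :: "'z set" and p g
  proof -
    have "(\<Sum>x | x \<in> X \<and> g \<le> p x. (-1) ^ c (p x) :: int)
      = (\<Sum>d | d \<in> D \<and> g \<le> d. \<Sum>x | x \<in> {x \<in> X. g \<le> p x} \<and> p x = d. (-1) ^ c (p x))"
      by (rule sum.group[symmetric]) (use that finD in auto)
    also have "\<dots> = (\<Sum>d | d \<in> D \<and> g \<le> d. (-1) ^ c d * int (card {x \<in> X. p x = d}))"
    proof (rule sum.cong[OF refl])
      fix d assume d: "d \<in> {d \<in> D. g \<le> d}"
      have "(\<Sum>x | x \<in> {x \<in> X. g \<le> p x} \<and> p x = d. (-1) ^ c (p x) :: int) = (\<Sum>x | x \<in> X \<and> p x = d. (-1) ^ c d)"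
        by (rule sum.cong) (use d in auto)
      then show "(\<Sum>x | x \<in> {x \<in> X. g \<le> p x} \<and> p x = d. (-1) ^ c (p x)) = (-1) ^ c d * int (card {x \<in> X. p x = d})"
        by simp
    qed
    finally show ?thesis .
  qed
  show ?thesis
  \<comment> \<open>Descending through \<open>D\<close>: the sums over the up-set of
    \<open>d\<close> agree, the fibres strictly above \<open>d\<close> agree by induction, and the
    sign is constant on a fibre.\<close>
  proof (induction "card {z \<in> D. d \<le> z}" arbitrary: d rule: less_induct)
    case less
    show ?case
    proof (cases "d \<in> D")
      case True
      let ?U = "{z \<in> D. d \<le> z}"
      let ?a = "\<lambda>z. (-1) ^ c z * int (card {x \<in> X. p x = z})"
      let ?b = "\<lambda>z. (-1) ^ c z * int (card {y \<in> Y. q y = z})"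
      have "sum ?a ?U = sum ?b ?U"
        using eq[of d] fibres[of X p d] fibres[of Y q d] fin by (simp add: D_def)
      moreover have "sum ?a (?U - {d}) = sum ?b (?U - {d})"
      proof (rule sum.cong[OF refl])
        fix z assume z: "z \<in> ?U - {d}"
        then have "d \<in> ?U" "d \<notin> {w \<in> D. z \<le> w}" using True by auto
        moreover have "{w \<in> D. z \<le> w} \<subseteq> ?U" using z by auto
        ultimately have "{w \<in> D. z \<le> w} \<subset> ?U" by blast
        then have "card {w \<in> D. z \<le> w} < card ?U" using finD by (intro psubset_card_mono) auto
        then show "?a z = ?b z" using less.hyps by simp
      qed
      moreover have "sum ?a ?U = ?a d + sum ?a (?U - {d})" "sum ?b ?U = ?b d + sum ?b (?U - {d})"
        using True finD by (intro sum.remove; simp)+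
      ultimately have "?a d = ?b d" by linarith
      then show ?thesis by simp
    qed (rule out)
  qed
qed

lemma card_eq_by_fibres:
  assumes "finite X" "finite Y" "\<And>d. card {x \<in> X. p x = d} = card {y \<in> Y. q y = d}"
  shows "card {x \<in> X. P (p x)} = card {y \<in> Y. P (q y)}"
proof -
  define D where "D = {d \<in> p ` X \<union> q ` Y. P d}"
  have fib: "card {x \<in> X. P (p x)} = (\<Sum>d\<in>D. card {x \<in> X. p x = d})"
    if "finite X" "{d \<in> p ` X. P d} \<subseteq> D" "\<forall>d\<in>D. P d" "finite D" for X :: "'z set" and p
  proof -
    have "p ` {x \<in> X. P (p x)} \<subseteq> D" using that(2) by blast
    then have "card {x \<in> X. P (p x)} = (\<Sum>d\<in>D. card {x \<in> {x \<in> X. P (p x)}. p x = d})"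
      using sum.group[of "{x \<in> X. P (p x)}" D p "\<lambda>_. 1::nat"] that(1,4) by simp
    also have "\<dots> = (\<Sum>d\<in>D. card {x \<in> X. p x = d})"
      by (rule sum.cong[OF refl], rule arg_cong[where f = card]) (use that in auto)
    finally show ?thesis .
  qed
  have D: "{d \<in> p ` X. P d} \<subseteq> D" "{d \<in> q ` Y. P d} \<subseteq> D" "\<forall>d\<in>D. P d" "finite D"
    using assms(1,2) by (auto simp: D_def)
  show ?thesis
    unfolding fib[OF assms(1) D(1,3,4)] fib[OF assms(2) D(2,3,4)]
    by (rule sum.cong[OF refl assms(3)])
qed

section \<open>Signed count of pairs\<close>

context bipartite
begin

text \<open>Both families satisfy that the sum of \<open>d\<close> plus the codimension is
  \<open>card V - 1\<close>, so the sign is a function of \<open>d\<close> alone, as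
  \<open>fibre_card_eq\<close> requires.\<close>

definition codim_of :: "('a \<Rightarrow> nat) \<Rightarrow> nat" where
  "codim_of d = card V - 1 - (\<Sum>e\<in>E. d e)"

text \<open>The value 0 outside \<open>E\<close> makes these vectors comparable with
  \<open>dvec\<close>. On \<open>pairs\<close> the subtraction is exact, because an inactive
  hyperedge has \<open>f e >= 1\<close>.\<close>

definition lower :: "('a \<Rightarrow> nat) \<times> 'a set \<Rightarrow> 'a \<Rightarrow> nat" where
  "lower p e = (if e \<in> E then fst p e - of_bool (e \<in> snd p) else 0)"

definition pairs :: "('a \<times> 'a) set \<Rightarrow> (('a \<Rightarrow> nat) \<times> 'a set) set" where
  "pairs r = (SIGMA f:{f \<in> extensional E. hypertree E V Ed f}. {S. S \<subseteq> E \<and> (\<forall>e\<in>S. internally_inactive r E V Ed f e)})"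

lemma finite_pairs: "finite (pairs r)"
  unfolding pairs_def by (intro finite_SigmaI finite_hypertrees) simp

lemma sum_lower:
  assumes "(f, S) \<in> pairs r"
  shows "(\<Sum>e\<in>E. lower (f, S) e) + card S = card V - 1"
proof -
  have S: "S \<subseteq> E" "\<And>e. e \<in> S \<Longrightarrow> f e \<ge> 1" and f: "hypertree E V Ed f"
    using assms by (auto simp: pairs_def internally_inactive_def)
  have "card S = (\<Sum>e\<in>E. of_bool (e \<in> S))"
    using S(1) by (simp add: sum.If_cases of_bool_def Int_absorb1)
  then have "(\<Sum>e\<in>E. lower (f, S) e) + card S = (\<Sum>e\<in>E. lower (f, S) e + of_bool (e \<in> S))"
    by (simp add: sum.distrib)
  also have "\<dots> = (\<Sum>e\<in>E. f e)"
    by (rule sum.cong) (use S(2) in \<open>auto simp: lower_def\<close>)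
  finally show ?thesis using hypertree_sum[OF f] by simp
qed

text \<open>For a hypertree above \<open>g\<close>, the admissible \<open>S\<close> are the sets of
  inactive hyperedges with \<open>f e > g e\<close>. Their signed sum vanishes unless there is no
  such hyperedge, which leaves the one hypertree of \<open>ex1_active_above\<close>.\<close>

lemma signed_sum_pairs:
  assumes r: "linear_order_on E r" and g: "\<And>e. e \<notin> E \<Longrightarrow> g e = 0"
  shows "(\<Sum>x | x \<in> pairs r \<and> g \<le> lower x. (-1) ^ codim_of (lower x)) =
    (of_bool (\<exists>h. hypertree E V Ed h \<and> (\<forall>e\<in>E. g e \<le> h e)) :: int)"
proof -
  let ?H = "{f \<in> extensional E. hypertree E V Ed f}"
  define \<S> where "\<S> f = {S. S \<subseteq> E \<and> (\<forall>e\<in>S. internally_inactive r E V Ed f e) \<and> g \<le> lower (f, S)}" for f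
  define good where "good f \<longleftrightarrow> (\<forall>e\<in>E. g e \<le> f e) \<and> (\<forall>e\<in>E. internally_inactive r E V Ed f e \<longrightarrow> f e = g e)" for f
  have le: "g \<le> lower (f, S) \<longleftrightarrow> (\<forall>e\<in>E. g e \<le> f e - of_bool (e \<in> S))" for f S
    using g by (auto simp: le_fun_def lower_def)
  have "(\<Sum>x | x \<in> pairs r \<and> g \<le> lower x. (-1) ^ codim_of (lower x) :: int)
      = (\<Sum>(f, S)\<in>Sigma ?H \<S>. (-1) ^ card S)"
  proof (rule sum.cong)
    show "{x. x \<in> pairs r \<and> g \<le> lower x} = Sigma ?H \<S>"
      by (auto simp: pairs_def \<S>_def)
    fix x assume "x \<in> Sigma ?H \<S>"
    then obtain f S where x: "x = (f, S)" "(f, S) \<in> pairs r" by (auto simp: pairs_def \<S>_def)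
    have "codim_of (lower (f, S)) = card S"
      using sum_lower[OF x(2)] unfolding codim_of_def by linarith
    then show "(-1) ^ codim_of (lower x) = ((case x of (f, S) \<Rightarrow> (-1) ^ card S) :: int)"
      by (simp add: x(1))
  qed
  also have "\<dots> = (\<Sum>f\<in>?H. \<Sum>S\<in>\<S> f. (-1) ^ card S)"
    by (rule sum.Sigma[symmetric]) (use finite_hypertrees in auto)
  also have "\<dots> = (\<Sum>f\<in>?H. of_bool (good f))"
  proof (rule sum.cong[OF refl])
    fix f assume f: "f \<in> ?H"
    show "(\<Sum>S\<in>\<S> f. (-1) ^ card S) = (of_bool (good f) :: int)"
    proof (cases "\<forall>e\<in>E. g e \<le> f e")
      case False
      have "\<S> f = {}"
      proof (rule ccontr)
        assume "\<S> f \<noteq> {}"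
        then obtain S where "\<forall>e\<in>E. g e \<le> f e - of_bool (e \<in> S)" by (auto simp: \<S>_def le)
        then show False using False by (meson diff_le_self le_trans)
      qed
      then show ?thesis using False by (simp add: good_def)
    next
      case gf: True
      show ?thesis
      proof (cases "good f")
        case True
        have "S = {}" if S: "S \<in> \<S> f" for S
        proof (rule ccontr)
          assume "S \<noteq> {}"
          then obtain e where e: "e \<in> S" "e \<in> E" "internally_inactive r E V Ed f e"
            using S by (auto simp: \<S>_def)
          then have "f e = g e" "f e \<ge> 1" using True by (auto simp: good_def internally_inactive_def)
          moreover have "g e \<le> f e - 1" using S e by (auto simp: \<S>_def le)
          ultimately show False by simp
        qed
        moreover have "{} \<in> \<S> f" using gf by (simp add: \<S>_def le)
        ultimately have "\<S> f = {{}}" by blast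
        then show ?thesis using True by simp
      next
        case False
        then obtain e where e: "e \<in> E" "internally_inactive r E V Ed f e" "f e \<noteq> g e"
          using gf by (auto simp: good_def)
        have "(\<Sum>S\<in>\<S> f. (-1) ^ card S) = (0::int)"
        proof (rule sum_sign_toggle[where t = e])
          fix S assume eS: "e \<notin> S"
          have "g e < f e" using gf e(1,3) by (simp add: order.strict_iff_order)
          then have "g x \<le> f x - of_bool (x \<in> insert e S) \<longleftrightarrow> g x \<le> f x - of_bool (x \<in> S)" if "x \<in> E" for x
            using eS by (cases "x = e") auto
          then show "insert e S \<in> \<S> f \<longleftrightarrow> S \<in> \<S> f"
            using e(1,2) by (auto simp: \<S>_def le)
        qed simp_all
        then show ?thesis using False by simp
      qed
    qed
  qed
  also have "\<dots> = int (card (?H \<inter> {f. good f}))"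
    by (rule sum_of_bool_eq; rule finite_hypertrees)
  also have "\<dots> = of_bool (\<exists>h. hypertree E V Ed h \<and> (\<forall>e\<in>E. g e \<le> h e))"
  proof (cases "\<exists>h. hypertree E V Ed h \<and> (\<forall>e\<in>E. g e \<le> h e)")
    case True
    then obtain h where h: "hypertree E V Ed h" "\<And>e. e \<in> E \<Longrightarrow> g e \<le> h e" by blast
    have "\<exists>!f. f \<in> ?H \<inter> {f. good f}"
      using ex1_active_above[OF r h] by (simp add: good_def conj_assoc)
    then obtain f where "?H \<inter> {f. good f} = {f}" by blast
    then show ?thesis using True by (simp only: card.insert) simp
  next
    case False
    then have "?H \<inter> {f. good f} = {}" by (auto simp: good_def)
    then show ?thesis using False by (simp only: card.empty) simp
  qed
  finally show ?thesis .
qed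

end

section \<open>Signed count of interior faces\<close>

context triangulated
begin

definition dvec :: "('a \<times> 'a) set \<Rightarrow> 'a \<Rightarrow> nat" where
  "dvec F e = (if e \<in> E then deg F e - 1 else 0)"

lemma deg_mono: "F \<subseteq> G \<Longrightarrow> deg F e \<le> deg G e" for F G :: "('a \<times> 'a) set"
  unfolding deg_def by (rule card_mono) auto

lemma hpoint_generic:
  assumes "hypertree E V Ed f" "T \<in> max_trees" "t \<in> T"
  shows "coef T t (hpoint f) \<noteq> 0"
  using coef_hpoint_sign[OF max_tree[OF assms(2)] assms(3) hypertree_sum[OF assms(1)]] by force

lemma hpoint_interior:
  assumes "hypertree E V Ed f"
  shows "hpoint f \<in> rel_interior Q"
proof -
  obtain T where T: "tree T" "\<And>e. e \<in> E \<Longrightarrow> deg T e = f e + 1"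
    using assms by (auto simp: hypertree_iff)
  show ?thesis
    using hpoint_sums(1)[OF hypertree_sum[OF assms]]
    by (intro tree_interior_point[OF T(1)] hpoint_W hypertree_sum assms coef_hpoint_pos[OF T])
      (simp_all add: height_def)
qed

lemma half_open_hpoint:
  assumes f: "hypertree E V Ed f"
  shows "T \<in> max_trees \<Longrightarrow> R \<subseteq> neg_edges T f \<Longrightarrow> T - R \<in> inner_faces"
    and "F \<in> inner_faces \<Longrightarrow> \<exists>!T. T \<in> max_trees \<and> F \<subseteq> T \<and> T - F \<subseteq> neg_edges T f"
proof -
  have neg: "T - F \<subseteq> {t. coef T t (hpoint f) < 0} \<longleftrightarrow> T - F \<subseteq> neg_edges T f" for T F
    by (auto simp: neg_edges_def)
  note q = hpoint_interior[OF f] hpoint_generic[OF f]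
  show "T - R \<in> inner_faces" if "T \<in> max_trees" "R \<subseteq> neg_edges T f"
    by (rule half_open_inner[OF q that(1)]) (use that(2) in \<open>auto simp: neg_edges_def\<close>)
  show "\<exists>!T. T \<in> max_trees \<and> F \<subseteq> T \<and> T - F \<subseteq> neg_edges T f" if "F \<in> inner_faces"
    using inner_half_open[OF q that] unfolding neg .
qed

text \<open>A maximal simplex containing \<open>hpoint f\<close> has no negative edge, so by
  \<open>neg_edges_source\<close> its tree realises \<open>f\<close>. Conversely, the point has only
  positive coordinates in every such tree, which gives uniqueness.\<close>

lemma ex1_max_tree:
  assumes f: "hypertree E V Ed f"
  shows "\<exists>!T. T \<in> max_trees \<and> (\<forall>e\<in>E. deg T e = f e + 1)"
proof -
  have "hpoint f \<in> Q" using hpoint_interior[OF f] rel_interior_subset by blast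
  then obtain T where T: "T \<in> max_trees" "hpoint f \<in> face T" by (rule Q_covered)
  have "0 \<le> coef T t (hpoint f)" if "t \<in> T" for t
    using T(2) in_tree_face_iff[OF max_tree[OF T(1)] subset_refl] that by blast
  then have "neg_edges T f = {}" by (force simp: neg_edges_def)
  then have "deg T e = f e + 1" if "e \<in> E" for e
    using neg_edges_source[OF max_tree[OF T(1)] hypertree_sum[OF f] that] by blast
  moreover have sub: "T1 \<subseteq> T2" if "T1 \<in> max_trees" "\<forall>e\<in>E. deg T1 e = f e + 1"
    "T2 \<in> max_trees" "\<forall>e\<in>E. deg T2 e = f e + 1" for T1 T2
  proof -
    have pos: "0 < coef T' t (hpoint f)" if "T' \<in> max_trees" "\<forall>e\<in>E. deg T' e = f e + 1" "t \<in> T'" for T' t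
      using coef_hpoint_pos[OF max_tree[OF that(1)]] that by blast
    have fc: "hpoint f \<in> face T'" if "T' \<in> max_trees" "\<forall>e\<in>E. deg T' e = f e + 1" for T'
      unfolding in_tree_face_iff[OF max_tree[OF that(1)] subset_refl]
      using pos[OF that] hpoint_W[OF hypertree_sum[OF f]] hpoint_sums(1)[OF hypertree_sum[OF f]]
      by (auto simp: height_def less_imp_le)
    show ?thesis
      by (rule support_subset[OF that(1,3) fc[OF that(1,2)] fc[OF that(3,4)]])
        (use pos[OF that(1,2)] in force)+
  qed
  ultimately show ?thesis using T(1) by (intro ex1I[of _ T]) blast+
qed

lemma max_trees_ne: "max_trees \<noteq> {}"
proof -
  have "Ed \<noteq> {}"
  proof
    assume "Ed = {}"
    then have "aff_dim Q = -1" unfolding Q_eq by simp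
    then show False using aff_dim_Q card_nodes card_pos by simp
  qed
  then have "Q \<noteq> {}" unfolding Q_eq by simp
  then show ?thesis using Q_covered by blast
qed

lemma inner_facesD:
  assumes "F \<in> inner_faces"
  obtains T where "T \<in> max_trees" "F \<subseteq> T"
  using assms by (auto simp: inner_faces_def)

text \<open>For any hypertree \<open>f\<close> the face lacks only negative edges of some maximal
  tree. Since \<open>hpoint f\<close> is positive at \<open>e\<close>, some edge at \<open>e\<close>
  has a positive coefficient and remains in the face.\<close>

lemma inner_deg_pos:
  assumes F: "F \<in> inner_faces" and e: "e \<in> E"
  shows "deg F e \<ge> 1"
proof -
  obtain T0 where T0: "T0 \<in> max_trees" using max_trees_ne by blast
  define f where "f e = deg T0 e - 1" for e
  have f: "hypertree E V Ed f"
    unfolding f_def by (rule tree_hypertree[OF max_tree[OF T0]])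
  obtain T where T: "T \<in> max_trees" "F \<subseteq> T" "T - F \<subseteq> neg_edges T f"
    using ex1_implies_ex[OF half_open_hpoint(2)[OF f F]] by (elim exE conjE) (rule that)
  have "0 < hpoint f $ e" using card_pos e by (simp add: hpoint_nth add_nonneg_pos)
  also have "\<dots> = (\<Sum>v | (e, v) \<in> T. coef T (e, v) (hpoint f))"
    by (rule coord_E[OF max_tree[OF T(1)] hpoint_W[OF hypertree_sum[OF f]] e])
  finally have pos: "0 < (\<Sum>v | (e, v) \<in> T. coef T (e, v) (hpoint f))" .
  obtain v where "(e, v) \<in> T" "0 < coef T (e, v) (hpoint f)"
  proof (rule ccontr)
    assume "\<not> thesis"
    then have "coef T (e, v) (hpoint f) \<le> 0" if "(e, v) \<in> T" for v
      using \<open>\<And>v. (e, v) \<in> T \<Longrightarrow> 0 < coef T (e, v) (hpoint f) \<Longrightarrow> thesis\<close> that by (meson not_le)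
    then have "(\<Sum>v | (e, v) \<in> T. coef T (e, v) (hpoint f)) \<le> 0" by (intro sum_nonpos) simp
    then show False using pos by simp
  qed
  then have "(e, v) \<in> F" using T(3) by (auto simp: neg_edges_def)
  then have "{v. (e, v) \<in> F} \<noteq> {}" by blast
  then have "card {v. (e, v) \<in> F} > 0" by (simp only: card_gt_0_iff finite simp_thms)
  then show ?thesis unfolding deg_def by linarith
qed

lemma sum_dvec:
  assumes F: "F \<in> inner_faces"
  shows "(\<Sum>e\<in>E. dvec F e) + card E = card F"
proof -
  have FEV: "F \<subseteq> E \<times> V" using inner_facesD[OF F] max_tree_subset by (metis subset_trans)
  have "(\<Sum>e\<in>E. dvec F e) + card E = (\<Sum>e\<in>E. Suc (dvec F e))" by (simp add: sum_Suc)
  also have "\<dots> = (\<Sum>e\<in>E. deg F e)"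
    by (rule sum.cong[OF refl]) (use inner_deg_pos[OF F] in \<open>force simp: dvec_def\<close>)
  also have "\<dots> = card {t \<in> F. fst t \<in> E}" by (rule sum_deg)
  also have "{t \<in> F. fst t \<in> E} = F" using FEV by auto
  finally show ?thesis .
qed

lemma codim_dvec:
  assumes "T \<in> max_trees" "R \<subseteq> T" "T - R \<in> inner_faces"
  shows "codim_of (dvec (T - R)) = card R"
proof -
  have "card (T - R) + card R = card T"
    using assms(2) card_mono[of T R] by (simp add: card_Diff_subset)
  then have "(\<Sum>e\<in>E. dvec (T - R) e) + card E + card R = card E + card V - 1"
    using sum_dvec[OF assms(3)] tree_card[OF max_tree[OF assms(1)]] card_nodes by simp
  then show ?thesis using card_pos by (simp add: codim_of_def)
qed

lemma signed_sum_inner_faces: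
  assumes g: "\<And>e. e \<notin> E \<Longrightarrow> g e = 0"
  shows "(\<Sum>F | F \<in> inner_faces \<and> g \<le> dvec F. (-1) ^ codim_of (dvec F)) =
    (of_bool (\<exists>h. hypertree E V Ed h \<and> (\<forall>e\<in>E. g e \<le> h e)) :: int)"
proof (cases "\<exists>h. hypertree E V Ed h \<and> (\<forall>e\<in>E. g e \<le> h e)")
  case False
  \<comment> \<open>A face above \<open>g\<close> would put the hypertree of a maximal tree
    containing it above \<open>g\<close>.\<close>
  have "\<not> g \<le> dvec F" if F: "F \<in> inner_faces" for F
  proof
    assume le: "g \<le> dvec F"
    obtain T where T: "T \<in> max_trees" "F \<subseteq> T" using inner_facesD[OF F] .
    have "g e \<le> deg T e - 1" if "e \<in> E" for e
      using le_funD[OF le, of e] deg_mono[OF T(2), of e] that by (simp add: dvec_def)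
    then show False using False tree_hypertree[OF max_tree[OF T(1)]] by blast
  qed
  then have "{F. F \<in> inner_faces \<and> g \<le> dvec F} = {}" by blast
  then show ?thesis using False by (simp only: sum.empty) simp
next
  case True
  then obtain f where f: "hypertree E V Ed f" and gf: "\<And>e. e \<in> E \<Longrightarrow> g e \<le> f e" by blast
  define \<R> where "\<R> T = {R. R \<subseteq> neg_edges T f \<and> g \<le> dvec (T - R)}" for T
  have le: "g \<le> dvec F \<longleftrightarrow> (\<forall>e\<in>E. g e \<le> deg F e - 1)" for F
    using g by (auto simp: le_fun_def dvec_def)
  have negT: "neg_edges T f \<subseteq> T" for T by (auto simp: neg_edges_def)
  note ho = half_open_hpoint[OF f]
  \<comment> \<open>The half-open simplices at \<open>hpoint f\<close> partition the interior faces,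
    so a face is the same as a tree together with the dropped negative edges.\<close>
  have bij: "bij_betw (\<lambda>(T, R). T - R) (Sigma max_trees \<R>) {F. F \<in> inner_faces \<and> g \<le> dvec F}"
    unfolding bij_betw_def
  proof (intro conjI inj_onI subset_antisym subsetI)
    fix p p' assume p: "p \<in> Sigma max_trees \<R>" "p' \<in> Sigma max_trees \<R>"
      and eq: "(case p of (T, R) \<Rightarrow> T - R) = (case p' of (T, R) \<Rightarrow> T - R)"
    obtain T R T' R' where pp: "p = (T, R)" "p' = (T', R')" by (cases p, cases p')
    have T: "T \<in> max_trees" "R \<subseteq> neg_edges T f" "T' \<in> max_trees" "R' \<subseteq> neg_edges T' f"
      using p by (auto simp: pp \<R>_def)
    have d: "T - (T - R) = R" "T' - (T' - R') = R'" using T negT by blast+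
    have e: "T - R = T' - R'" using eq by (simp add: pp)
    have ex1: "\<exists>!S. S \<in> max_trees \<and> T - R \<subseteq> S \<and> S - (T - R) \<subseteq> neg_edges S f"
      by (rule ho(2)[OF ho(1)[OF T(1,2)]])
    have 1: "T \<in> max_trees \<and> T - R \<subseteq> T \<and> T - (T - R) \<subseteq> neg_edges T f"
      unfolding d(1) using T(1,2) by blast
    have 2: "T' \<in> max_trees \<and> T - R \<subseteq> T' \<and> T' - (T - R) \<subseteq> neg_edges T' f"
      unfolding e d(2) using T(3,4) by blast
    have TT: "T = T'"
      by (rule trans[OF sym[OF the1_equality[OF ex1 1]] the1_equality[OF ex1 2]])
    have "R = R'" using d TT e by blast
    with TT show "p = p'" unfolding pp by blast
  next
    fix F assume "F \<in> (\<lambda>(T, R). T - R) ` Sigma max_trees \<R>"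
    then show "F \<in> {F. F \<in> inner_faces \<and> g \<le> dvec F}" using ho(1) by (auto simp: \<R>_def)
  next
    fix F assume F: "F \<in> {F. F \<in> inner_faces \<and> g \<le> dvec F}"
    then obtain T where T: "T \<in> max_trees" "F \<subseteq> T" "T - F \<subseteq> neg_edges T f"
      using ex1_implies_ex[OF ho(2)[of F]] by auto
    then have "T - (T - F) = F" by blast
    then show "F \<in> (\<lambda>(T, R). T - R) ` Sigma max_trees \<R>"
      using F T by (intro image_eqI[of _ _ "(T, T - F)"]) (auto simp: \<R>_def)
  qed
  have "(\<Sum>F | F \<in> inner_faces \<and> g \<le> dvec F. (-1) ^ codim_of (dvec F) :: int)
      = (\<Sum>(T, R)\<in>Sigma max_trees \<R>. (-1) ^ codim_of (dvec (T - R)))"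
    by (subst sum.reindex_bij_betw[OF bij, symmetric]) (simp add: case_prod_unfold)
  also have "\<dots> = (\<Sum>(T, R)\<in>Sigma max_trees \<R>. (-1) ^ card R)"
  proof (rule sum.cong[OF refl])
    fix p assume "p \<in> Sigma max_trees \<R>"
    then obtain T R where p: "p = (T, R)" "T \<in> max_trees" "R \<subseteq> neg_edges T f" by (auto simp: \<R>_def)
    then have "codim_of (dvec (T - R)) = card R"
      using ho(1)[OF p(2,3)] negT by (intro codim_dvec) auto
    then show "((case p of (T, R) \<Rightarrow> (-1) ^ codim_of (dvec (T - R))) :: int) = (case p of (T, R) \<Rightarrow> (-1) ^ card R)"
      by (simp add: p(1))
  qed
  also have "\<dots> = (\<Sum>T\<in>max_trees. \<Sum>R\<in>\<R> T. (-1) ^ card R)"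
    by (rule sum.Sigma[symmetric]) auto
  also have "\<dots> = (\<Sum>T\<in>max_trees. of_bool (\<forall>e\<in>E. deg T e = f e + 1))"
  proof (rule sum.cong[OF refl])
    fix T assume T: "T \<in> max_trees"
    show "(\<Sum>R\<in>\<R> T. (-1) ^ card R) = (of_bool (\<forall>e\<in>E. deg T e = f e + 1) :: int)"
    proof (cases "\<forall>e\<in>E. deg T e = f e + 1")
      case True
      then have "\<not> coef T t (hpoint f) < 0" if "t \<in> T" for t
        using coef_hpoint_pos[OF max_tree[OF T] _ that, of f] by simp
      then have "neg_edges T f = {}" by (simp add: neg_edges_def)
      moreover have "g \<le> dvec T" unfolding le using True gf by simp
      ultimately have "\<R> T = {{}}" by (auto simp: \<R>_def)
      then show ?thesis using True by simp
    next
      case False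
      then obtain e0 where e0: "e0 \<in> E" "deg T e0 \<noteq> f e0 + 1" by blast
      obtain t where t: "t \<in> neg_edges T f"
        and slack: "card {v. (fst t, v) \<in> neg_edges T f} + f (fst t) + 1 \<le> deg T (fst t)"
        using neg_edges_source[OF max_tree[OF T] hypertree_sum[OF f] e0] by blast
      have tE: "fst t \<in> E" using subsetD[OF max_tree_subset[OF T] subsetD[OF negT t]] by auto
      \<comment> \<open>Even if all negative edges at the source are dropped, \<open>f + 1\<close>
        edges remain there. The bound by \<open>g\<close> thus never restricts the choice of
        \<open>t\<close>.\<close>
      have big: "g (fst t) \<le> deg (T - R) (fst t) - 1" if R: "R \<subseteq> neg_edges T f" for R
      proof -
        have "{v. (fst t, v) \<in> T} \<subseteq> {v. (fst t, v) \<in> T - R} \<union> {v. (fst t, v) \<in> neg_edges T f}"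
          using R by auto
        then have "deg T (fst t) \<le> card ({v. (fst t, v) \<in> T - R} \<union> {v. (fst t, v) \<in> neg_edges T f})"
          unfolding deg_def by (intro card_mono finite)
        also have "\<dots> \<le> deg (T - R) (fst t) + card {v. (fst t, v) \<in> neg_edges T f}"
          unfolding deg_def by (rule card_Un_le)
        finally show ?thesis using slack gf[OF tE] by linarith
      qed
      have "(\<Sum>R\<in>\<R> T. (-1) ^ card R) = (0::int)"
      proof (rule sum_sign_toggle[where t = t])
        fix R assume "t \<notin> R"
        have same: "deg (T - insert t R) x = deg (T - R) x" if "x \<noteq> fst t" for x
          unfolding deg_def by (rule arg_cong[where f = card]) (use that in auto)
        show "insert t R \<in> \<R> T \<longleftrightarrow> R \<in> \<R> T"
        proof (cases "R \<subseteq> neg_edges T f")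
          case True
          then have "insert t R \<subseteq> neg_edges T f" using t by blast
          moreover have "g \<le> dvec (T - insert t R) \<longleftrightarrow> g \<le> dvec (T - R)"
          proof -
            have "g x \<le> deg (T - insert t R) x - 1 \<longleftrightarrow> g x \<le> deg (T - R) x - 1" for x
            proof (cases "x = fst t")
              case x: True
              then show ?thesis
                using big[OF True] big[OF \<open>insert t R \<subseteq> neg_edges T f\<close>] by (simp only:)
            next
              case False
              show ?thesis unfolding same[OF False] by (rule refl)
            qed
            then show ?thesis unfolding le by (simp only:)
          qed
          ultimately show ?thesis using True by (simp add: \<R>_def)
        next
          case False
          then show ?thesis by (auto simp: \<R>_def)
        qed
      qed simp_all
      then show ?thesis using False by simp
    qed
  qed
  also have "\<dots> = int (card (max_trees \<inter> {T. \<forall>e\<in>E. deg T e = f e + 1}))"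
    by (rule sum_of_bool_eq; simp)
  also have "\<dots> = 1"
  proof -
    have "max_trees \<inter> {T. \<forall>e\<in>E. deg T e = f e + 1} = {T. T \<in> max_trees \<and> (\<forall>e\<in>E. deg T e = f e + 1)}"
      by blast
    then show ?thesis using card_ex1[OF ex1_max_tree[OF f]] by presburger
  qed
  finally show ?thesis using True by simp
qed

lemma inner_faces_pairs_card:
  assumes r: "linear_order_on E r"
  shows "card {F \<in> inner_faces. P (dvec F)} = card {x \<in> pairs r. P (lower x)}"
proof (rule card_eq_by_fibres[where p = dvec and q = lower and P = P])
  show "card {F \<in> inner_faces. dvec F = d} = card {x \<in> pairs r. lower x = d}" for d
  proof (rule fibre_card_eq[where c = codim_of])
    fix g :: "'a \<Rightarrow> nat"
    show "(\<Sum>F | F \<in> inner_faces \<and> g \<le> dvec F. (-1) ^ codim_of (dvec F)) =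
      (\<Sum>x | x \<in> pairs r \<and> g \<le> lower x. (-1) ^ codim_of (lower x) :: int)"
    proof (cases "\<forall>e. e \<notin> E \<longrightarrow> g e = 0")
      case True
      then show ?thesis using signed_sum_inner_faces[of g] signed_sum_pairs[OF r, of g] by simp
    next
      case False
      \<comment> \<open>Both kinds of vectors vanish off \<open>E\<close>, so both sums are
        empty.\<close>
      then obtain e where "e \<notin> E" "g e > 0" by auto
      then have "\<not> g \<le> dvec F" "\<not> g \<le> lower x" for F x
        by (auto simp: le_fun_def dvec_def lower_def intro!: exI[of _ e])
      then show ?thesis by simp
    qed
  qed (simp_all add: finite_pairs)
qed (simp_all add: finite_pairs)

end

theorem theorem5p1:
  fixes E V :: "'a::finite set" and Ed :: "('a \<times> 'a) set"
    and r :: "('a \<times> 'a) set" and \<T> :: "(real ^ 'a) set set" and k :: nat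
  assumes "E \<union> V = UNIV" and "E \<inter> V = {}" and "E \<noteq> {}" and "V \<noteq> {}"
    and "Ed \<subseteq> E \<times> V"
    and "connected_by (E \<union> V) Ed"
    and "triangulation (root_polytope Ed) \<T>"
    and "linear_order_on E r"
  shows "card {\<sigma>. (\<exists>\<tau>\<in>\<T>. \<sigma> \<subseteq> \<tau>) \<and>
                 \<not> (convex hull \<sigma> \<subseteq> rel_frontier (root_polytope Ed)) \<and>
                 aff_dim (convex hull \<sigma>) = int (card E + card V) - 2 - int k}
       = card {(f, S). f \<in> extensional E \<and> hypertree E V Ed f \<and>
                 S \<subseteq> E \<and> card S = k \<and> (\<forall>e\<in>S. internally_inactive r E V Ed f e)}"
proof -
  interpret triangulated E V Ed \<T>
    using assms by unfold_locales
  \<comment> \<open>The codimension condition in additive form. It avoids truncated subtraction and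
    is therefore false on both sides when \<open>k\<close> exceeds
    \<open>card V - 1\<close>.\<close>
  let ?P = "\<lambda>d. (\<Sum>e\<in>E. d e) + k = card V - 1"
  have dim: "aff_dim (face F) = int (card E + card V) - 2 - int k \<longleftrightarrow> ?P (dvec F)"
    if F: "F \<in> inner_faces" for F
  proof -
    obtain T where T: "T \<in> max_trees" "F \<subseteq> T" using inner_facesD[OF F] .
    show ?thesis
      using aff_dim_forest[OF max_tree[OF T(1)] T(2)] sum_dvec[OF F] card_pos by linarith
  qed
  have "{\<sigma>. (\<exists>\<tau>\<in>\<T>. \<sigma> \<subseteq> \<tau>) \<and> \<not> (convex hull \<sigma> \<subseteq> rel_frontier Q) \<and>
      aff_dim (convex hull \<sigma>) = int (card E + card V) - 2 - int k}
    = (`) edge_vec ` {F \<in> inner_faces. ?P (dvec F)}" (is "?L = ?R")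
  proof (intro subset_antisym subsetI)
    fix \<sigma> assume s: "\<sigma> \<in> ?L"
    then obtain \<tau> where "\<tau> \<in> \<T>" "\<sigma> \<subseteq> \<tau>" by blast
    then obtain T where T: "T \<in> max_trees" "\<sigma> \<subseteq> edge_vec ` T" by (metis simplex_max_tree)
    then obtain F where F: "F \<subseteq> T" "\<sigma> = edge_vec ` F" by (meson subset_image_iff)
    have "F \<in> inner_faces" using s T(1) F by (auto simp: inner_faces_def)
    then show "\<sigma> \<in> ?R" using dim s F(2) by blast
  next
    fix \<sigma> assume "\<sigma> \<in> ?R"
    then obtain F where F: "F \<in> inner_faces" "?P (dvec F)" "\<sigma> = edge_vec ` F" by blast
    obtain T where T: "T \<in> max_trees" "F \<subseteq> T" using inner_facesD[OF F(1)] .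
    have "edge_vec ` T \<in> \<T>" "\<sigma> \<subseteq> edge_vec ` T" using T F(3) by (auto simp: max_trees_def)
    moreover have "\<not> face F \<subseteq> rel_frontier Q" using F(1) by (simp add: inner_faces_def)
    ultimately show "\<sigma> \<in> ?L" using dim[OF F(1)] F(2,3) by blast
  qed
  \<comment> \<open>This passes from counting point sets to counting edge sets.\<close>
  moreover have "inj_on ((`) edge_vec) {F \<in> inner_faces. ?P (dvec F)}"
    by (rule inj_on_subset[OF inj_on_image_Pow[OF inj_edge_vec]])
      (use inner_facesD max_tree_subset in blast)
  ultimately have "card ?L = card {F \<in> inner_faces. ?P (dvec F)}"
    by (simp add: card_image)
  also have "\<dots> = card {x \<in> pairs r. ?P (lower x)}"
    by (rule inner_faces_pairs_card[OF assms(8)])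
  also have "{x \<in> pairs r. ?P (lower x)} = {(f, S). f \<in> extensional E \<and> hypertree E V Ed f \<and>
                 S \<subseteq> E \<and> card S = k \<and> (\<forall>e\<in>S. internally_inactive r E V Ed f e)}"
  proof -
    have "?P (lower (f, S)) \<longleftrightarrow> card S = k" if "(f, S) \<in> pairs r" for f S
      using sum_lower[OF that] by linarith
    then show ?thesis by (auto simp: pairs_def)
  qed
  finally show ?thesis .
qed

end
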